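(* Let $M$ be a surface immersed in $\mathbb{R}^4$, let $m\in M$, and let $v\in T_mM$ be a unit vector with $\alpha(v,v)\neq 0$. Then the normal curvature of $M$ at $m$ in the direction $v$ is $\kappa_v=\|\alpha(v,v)\|$, and the normal torsion of $M$ at $m$ in the direction $v$ is $$\tau_v = \frac{J\alpha(v,v)\cdot(\nabla_v\alpha)(v,v)}{\alpha(v,v)\cdot\alpha(v,v)}=\frac{J\gamma_v''(0)\cdot\gamma_v'''(0)}{\gamma_v''(0)\cdot\gamma_v''(0)},$$ where $\gamma_v$ is the geodesic of $M$ with $\gamma_v(0)=m$, $\gamma_v'(0)=v$, regarded as a curve in $\mathbb{R}^4$.
   Context: $D$ denotes the directional derivative in $\mathbb{R}^4$, $N_mM$ the normal plane of $M$ at $m$, and $X=X^\top+X^\bot$ the decomposition into tangent and normal parts. The second fundamental form is $\alpha(X,Y)=(D_XY)^\bot$; with $\nabla^\top_XY=(D_XY)^\top$ and $\nabla^\bot_Xu=(D_Xu)^\bot$, its covariant derivative is $(\nabla_X\alpha)(Y,Z)=\nabla^\bot_X(\alpha(Y,Z))-\alpha(\nabla^\top_XY,Z)-\alpha(Y,\nabla^\top_XZ)$. Normal section: the intersection of $M$ (near $m$) with the affine 3-space through $m$ generated by $v$ and $N_mM$ is a curve through $m$, called the normal section of $M$ determined by $v$. The normal curvature and the normal torsion of $M$ at $m$ in the direction $v$ are the curvature and the torsion at $m$ of this curve, as a curve in that Euclidean affine 3-space. Orientation: $N_mM$ is given an orientation, $J$ on $N_mM$ is the positive rotation by 90 degrees,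 and the 3-space spanned by $v$ and $N_mM$ is oriented so that $v\times w=Jw$ for $w\in N_mM$. For a curve $\mu$ in an oriented Euclidean 3-space, the torsion is $\frac{(\mu'\times\mu'')\cdot\mu'''}{\|\mu'\times\mu''\|^2}$. *)

theory Defs
  imports "HOL-Analysis.Analysis"
begin

section \<open>Smooth maps and curves in Euclidean space\<close>

text \<open>Class \<open>C\<^sup>k\<close> and \<open>C\<^sup>\<infinity>\<close> on an \<^emph>\<open>open\<close> subset of a Euclidean space; only open sets
  occur below.\<close>

primrec Ck_on :: "nat \<Rightarrow> ('b::euclidean_space \<Rightarrow> 'c::real_normed_vector) \<Rightarrow> 'b set \<Rightarrow> bool" where
  "Ck_on 0 f U \<longleftrightarrow> continuous_on U f"
| "Ck_on (Suc k) f U \<longleftrightarrow>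
     f differentiable_on U \<and> (\<forall>h. Ck_on k (\<lambda>x. frechet_derivative f (at x) h) U)"

definition smooth_on :: "'b::euclidean_space set \<Rightarrow> ('b \<Rightarrow> 'c::real_normed_vector) \<Rightarrow> bool" where
  "smooth_on U f \<longleftrightarrow> (\<forall>k. Ck_on k f U)"

definition nth_deriv :: "nat \<Rightarrow> (real \<Rightarrow> 'b::real_normed_vector) \<Rightarrow> real \<Rightarrow> 'b" where
  "nth_deriv k \<mu> = ((\<lambda>\<nu> t. vector_derivative \<nu> (at t)) ^^ k) \<mu>"

text \<open>Curvature is the rate of change of the unit tangent with respect to arc length.\<close>

definition curvature :: "(real \<Rightarrow> 'b::real_inner) \<Rightarrow> real \<Rightarrow> real" where
  "curvature \<mu> t =
     norm (vector_derivative (\<lambda>s. nth_deriv 1 \<mu> s /\<^sub>R norm (nth_deriv 1 \<mu> s)) (at t))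
       / norm (nth_deriv 1 \<mu> t)"

definition torsion :: "(real \<Rightarrow> real^3) \<Rightarrow> real \<Rightarrow> real" where
  "torsion \<mu> t =
     ((cross3 (nth_deriv 1 \<mu> t) (nth_deriv 2 \<mu> t)) \<bullet> nth_deriv 3 \<mu> t)
       / (norm (cross3 (nth_deriv 1 \<mu> t) (nth_deriv 2 \<mu> t)))\<^sup>2"


section \<open>Immersed surfaces in four-space\<close>

text \<open>The abstract surface is a Hausdorff, second countable type \<open>'a\<close> together with an atlas of
  local parametrizations \<open>(U, x)\<close>, where \<open>x\<close> maps the open set \<open>U\<close> of the plane onto an open set of
  the surface.  The immersion \<open>F\<close> need not be injective, so all local objects are attached
  to points \<open>p\<close> of the abstract surface rather than to their images \<open>F p\<close>.\<close>

type_synonym 'a atlas = "((real^2) set \<times> (real^2 \<Rightarrow> 'a)) set"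

definition surface_atlas :: "'a::{t2_space,second_countable_topology} atlas \<Rightarrow> bool" where
  "surface_atlas A \<longleftrightarrow>
     (\<forall>(U, x) \<in> A. open U \<and> open (x ` U) \<and> homeomorphism U (x ` U) x (inv_into U x)) \<and>
     (\<Union>(U, x) \<in> A. x ` U) = UNIV \<and>
     (\<forall>(U, x) \<in> A. \<forall>(V, y) \<in> A. smooth_on {u \<in> U. x u \<in> y ` V} (inv_into V y \<circ> x))"

definition immersed_surface ::
  "'a::{t2_space,second_countable_topology} atlas \<Rightarrow> ('a \<Rightarrow> real^4) \<Rightarrow> bool" where
  "immersed_surface A F \<longleftrightarrow> surface_atlas A \<and>
     (\<forall>(U, x) \<in> A. smooth_on U (F \<circ> x) \<and>
        (\<forall>u \<in> U. inj (frechet_derivative (F \<circ> x) (at u))))"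

definition tangent_plane :: "'a atlas \<Rightarrow> ('a \<Rightarrow> real^4) \<Rightarrow> 'a \<Rightarrow> (real^4) set" where
  "tangent_plane A F p =
     {frechet_derivative (F \<circ> x) (at u) h | U x u h. (U, x) \<in> A \<and> u \<in> U \<and> x u = p}"

definition normal_plane :: "'a atlas \<Rightarrow> ('a \<Rightarrow> real^4) \<Rightarrow> 'a \<Rightarrow> (real^4) set" where
  "normal_plane A F p = orthogonal_comp (tangent_plane A F p)"

definition tan_part :: "'a atlas \<Rightarrow> ('a \<Rightarrow> real^4) \<Rightarrow> 'a \<Rightarrow> real^4 \<Rightarrow> real^4" where
  "tan_part A F p X = (THE Y. Y \<in> tangent_plane A F p \<and> X - Y \<in> normal_plane A F p)"

definition nor_part :: "'a atlas \<Rightarrow> ('a \<Rightarrow> real^4) \<Rightarrow> 'a \<Rightarrow> real^4 \<Rightarrow> real^4" where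
  "nor_part A F p X = (THE Y. Y \<in> normal_plane A F p \<and> X - Y \<in> tangent_plane A F p)"

text \<open>\<open>dir_deriv A F p X Y\<close> is \<open>D\<^sub>X Y\<close> at \<open>p\<close>, for a tangent vector \<open>X\<close> at \<open>p\<close> and a vector field \<open>Y\<close>
  along the immersion (with values in four-space).\<close>

definition dir_deriv ::
  "'a atlas \<Rightarrow> ('a \<Rightarrow> real^4) \<Rightarrow> 'a \<Rightarrow> real^4 \<Rightarrow> ('a \<Rightarrow> real^4) \<Rightarrow> real^4" where
  "dir_deriv A F p X Y =
     (THE D. \<exists>U x u h. (U, x) \<in> A \<and> u \<in> U \<and> x u = p \<and>
        X = frechet_derivative (F \<circ> x) (at u) h \<and>
        D = frechet_derivative (Y \<circ> x) (at u) h)"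

definition tangent_field ::
  "'a::topological_space atlas \<Rightarrow> ('a \<Rightarrow> real^4) \<Rightarrow> 'a set \<Rightarrow> ('a \<Rightarrow> real^4) \<Rightarrow> bool" where
  "tangent_field A F W X \<longleftrightarrow> open W \<and> (\<forall>q \<in> W. X q \<in> tangent_plane A F q) \<and>
     (\<forall>(U, x) \<in> A. smooth_on {u \<in> U. x u \<in> W} (X \<circ> x))"


section \<open>Second fundamental form and its covariant derivative\<close>

text \<open>First on vector fields.\<close>

definition nabla_tan ::
  "'a atlas \<Rightarrow> ('a \<Rightarrow> real^4) \<Rightarrow> ('a \<Rightarrow> real^4) \<Rightarrow> ('a \<Rightarrow> real^4) \<Rightarrow> 'a \<Rightarrow> real^4" where
  "nabla_tan A F X Y q = tan_part A F q (dir_deriv A F q (X q) Y)"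

definition nabla_nor ::
  "'a atlas \<Rightarrow> ('a \<Rightarrow> real^4) \<Rightarrow> ('a \<Rightarrow> real^4) \<Rightarrow> ('a \<Rightarrow> real^4) \<Rightarrow> 'a \<Rightarrow> real^4" where
  "nabla_nor A F X u q = nor_part A F q (dir_deriv A F q (X q) u)"

definition sff_field ::
  "'a atlas \<Rightarrow> ('a \<Rightarrow> real^4) \<Rightarrow> ('a \<Rightarrow> real^4) \<Rightarrow> ('a \<Rightarrow> real^4) \<Rightarrow> 'a \<Rightarrow> real^4" where
  "sff_field A F X Y q = nor_part A F q (dir_deriv A F q (X q) Y)"

definition nabla_sff_field ::
  "'a atlas \<Rightarrow> ('a \<Rightarrow> real^4) \<Rightarrow> ('a \<Rightarrow> real^4) \<Rightarrow> ('a \<Rightarrow> real^4) \<Rightarrow> ('a \<Rightarrow> real^4) \<Rightarrow> 'a \<Rightarrow> real^4" where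
  "nabla_sff_field A F X Y Z q =
     nabla_nor A F X (sff_field A F Y Z) q
       - sff_field A F (nabla_tan A F X Y) Z q
       - sff_field A F Y (nabla_tan A F X Z) q"

text \<open>Then as tensors at a point: the common value over all local extensions of the given tangent
  vectors to smooth tangent fields.\<close>

definition sff ::
  "'a::topological_space atlas \<Rightarrow> ('a \<Rightarrow> real^4) \<Rightarrow> 'a \<Rightarrow> real^4 \<Rightarrow> real^4 \<Rightarrow> real^4" where
  "sff A F p v w =
     (THE n. \<exists>W X Y. p \<in> W \<and> tangent_field A F W X \<and> tangent_field A F W Y \<and>
        X p = v \<and> Y p = w \<and> n = sff_field A F X Y p)"

definition nabla_sff ::
  "'a::topological_space atlas \<Rightarrow> ('a \<Rightarrow> real^4) \<Rightarrow> 'a \<Rightarrow> real^4 \<Rightarrow> real^4 \<Rightarrow> real^4 \<Rightarrow> real^4" where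
  "nabla_sff A F p u v w =
     (THE n. \<exists>W X Y Z. p \<in> W \<and> tangent_field A F W X \<and> tangent_field A F W Y \<and>
        tangent_field A F W Z \<and> X p = u \<and> Y p = v \<and> Z p = w \<and>
        n = nabla_sff_field A F X Y Z p)"


section \<open>Curves on the surface\<close>

definition smooth_curve ::
  "'a::topological_space atlas \<Rightarrow> real set \<Rightarrow> (real \<Rightarrow> 'a) \<Rightarrow> bool" where
  "smooth_curve A I c \<longleftrightarrow> continuous_on I c \<and>
     (\<forall>(U, x) \<in> A. smooth_on {t \<in> I. c t \<in> x ` U} (inv_into U x \<circ> c))"

definition geodesic ::
  "'a::topological_space atlas \<Rightarrow> ('a \<Rightarrow> real^4) \<Rightarrow> real set \<Rightarrow> (real \<Rightarrow> 'a) \<Rightarrow> bool" where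
  "geodesic A F I c \<longleftrightarrow> open I \<and> is_interval I \<and> smooth_curve A I c \<and>
     (\<forall>t \<in> I. tan_part A F (c t) (nth_deriv 2 (F \<circ> c) t) = 0)"

text \<open>\<open>c\<close> is a regular parametrization, with \<open>c 0 = p\<close>, of the normal section at \<open>p\<close> determined
  by \<open>v\<close>: near \<open>p\<close>, the points which \<open>F\<close> sends into the affine space through \<open>F p\<close> generated by
  \<open>v\<close> and the normal plane.\<close>

definition normal_section ::
  "'a::topological_space atlas \<Rightarrow> ('a \<Rightarrow> real^4) \<Rightarrow> 'a \<Rightarrow> real^4 \<Rightarrow> (real \<Rightarrow> 'a) \<Rightarrow> bool" where
  "normal_section A F p v c \<longleftrightarrow> c 0 = p \<and>
     (\<exists>\<epsilon>>0. \<exists>W. open W \<and> p \<in> W \<and>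
        smooth_curve A {-\<epsilon><..<\<epsilon>} c \<and> inj_on c {-\<epsilon><..<\<epsilon>} \<and>
        (\<forall>t \<in> {-\<epsilon><..<\<epsilon>}. nth_deriv 1 (F \<circ> c) t \<noteq> 0) \<and>
        c ` {-\<epsilon><..<\<epsilon>} = {q \<in> W. F q - F p \<in> span (insert v (normal_plane A F p))})"

definition normal_curvature ::
  "'a::topological_space atlas \<Rightarrow> ('a \<Rightarrow> real^4) \<Rightarrow> 'a \<Rightarrow> real^4 \<Rightarrow> real" where
  "normal_curvature A F p v =
     (THE \<kappa>. \<exists>c. normal_section A F p v c \<and> \<kappa> = curvature (F \<circ> c) 0)"


section \<open>Orientation and normal torsion\<close>

text \<open>An orientation of the normal plane is given by an ordered orthonormal basis \<open>(e1, e2)\<close>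
  declared positive; \<open>rot90 e1 e2\<close> is then the positive rotation \<open>J\<close> by 90 degrees.\<close>

definition normal_frame ::
  "'a atlas \<Rightarrow> ('a \<Rightarrow> real^4) \<Rightarrow> 'a \<Rightarrow> real^4 \<Rightarrow> real^4 \<Rightarrow> bool" where
  "normal_frame A F p e1 e2 \<longleftrightarrow>
     e1 \<in> normal_plane A F p \<and> e2 \<in> normal_plane A F p \<and>
     norm e1 = 1 \<and> norm e2 = 1 \<and> e1 \<bullet> e2 = 0"

definition rot90 :: "real^4 \<Rightarrow> real^4 \<Rightarrow> real^4 \<Rightarrow> real^4" where
  "rot90 e1 e2 w = (w \<bullet> e1) *\<^sub>R e2 - (w \<bullet> e2) *\<^sub>R e1"

text \<open>Coordinates in the orthonormal frame \<open>(v, e1, e2)\<close> identify the three-space spanned by \<open>v\<close>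
  and the normal plane, oriented by this frame, with the standard oriented \<open>real^3\<close>.
  By the lemma below this is the orientation for which \<open>v \<times> w = J w\<close>.\<close>

definition frame_coords :: "real^4 \<Rightarrow> real^4 \<Rightarrow> real^4 \<Rightarrow> real^4 \<Rightarrow> real^3" where
  "frame_coords v e1 e2 y = vector [y \<bullet> v, y \<bullet> e1, y \<bullet> e2]"

lemma cross3_frame_coords:
  assumes "normal_frame A F p e1 e2" "v \<in> tangent_plane A F p" "norm v = 1"
    and "w \<in> normal_plane A F p"
  shows "cross3 (frame_coords v e1 e2 v) (frame_coords v e1 e2 w)
           = frame_coords v e1 e2 (rot90 e1 e2 w)"
proof -
  have "v \<bullet> n = 0" "n \<bullet> v = 0" if "n \<in> normal_plane A F p" for n
    using that assms(2)
    by (auto simp: normal_plane_def orthogonal_comp_def orthogonal_def inner_commute)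
  moreover have "v \<bullet> v = 1" "e1 \<bullet> e1 = 1" "e2 \<bullet> e2 = 1"
    using assms by (auto simp: normal_frame_def norm_eq_1)
  ultimately show ?thesis
    using assms
    by (auto simp: normal_frame_def rot90_def frame_coords_def cross3_def inner_diff_right
        inner_commute vector_3)
qed

definition normal_torsion ::
  "'a::topological_space atlas \<Rightarrow> ('a \<Rightarrow> real^4) \<Rightarrow> 'a \<Rightarrow> real^4 \<Rightarrow> real^4 \<Rightarrow> real^4 \<Rightarrow> real" where
  "normal_torsion A F p e1 e2 v =
     (THE \<tau>. \<exists>c. normal_section A F p v c \<and>
        \<tau> = torsion (\<lambda>t. frame_coords v e1 e2 (F (c t) - F p)) 0)"

end

theory Submission
  imports Defs
begin

text \<open>
  Let \<open>\<mu>\<close> be the image in four-space of a curve on the surface whose velocity at \<open>p\<close> is \<open>\<rho> v\<close>,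
  and whose acceleration at \<open>p\<close> has tangential part \<open>\<sigma> v\<close>.  Then the normal parts of its second and third
  derivatives are determined by the second fundamental form and its covariant derivative (lemma \<open>curve_normal_parts\<close>):

    \<open>\<mu>''\<close> has normal part \<open>\<rho>\<^sup>2 \<alpha>(v, v)\<close>, and
    \<open>\<mu>'''\<close> has normal part \<open>\<rho>\<^sup>3 (\<nabla>\<^sub>v\<alpha>)(v, v) + 3 \<rho> \<sigma> \<alpha>(v, v)\<close>.

  A geodesic with velocity \<open>v\<close> is the case \<open>\<rho> = 1\<close>, \<open>\<sigma> = 0\<close>, so that \<open>\<gamma>'' = \<alpha>(v, v)\<close> and \<open>\<gamma>'''\<close> has
  normal part \<open>(\<nabla>\<^sub>v\<alpha>)(v, v)\<close>.  A normal section also falls under this description: it stays in the three-space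
  orthogonal to the tangent direction \<open>w\<close> perpendicular to \<open>v\<close>, so all its derivatives are
  orthogonal to \<open>w\<close>, and the tangential parts of velocity and acceleration are multiples of \<open>v\<close>
  (\<open>normal_section_derivatives\<close>).  In its three-space, \<open>\<mu>' \<times> \<mu>'' = \<rho>\<^sup>3 J\<alpha>(v, v)\<close>.  Since \<open>J\<alpha>\<close> is
  orthogonal to \<open>\<alpha>\<close>, the term with \<open>\<sigma>\<close> drops out of the triple product with \<open>\<mu>'''\<close>, and all
  powers of \<open>\<rho>\<close> cancel.  This gives the formulas for curvature and torsion, for every
  regular parametrization of the section.

  Two facts make the definite descriptions meaningful.  A smooth regular parametrization of
  the normal section exists, by the inverse function theorem (\<open>normal_section_exists\<close>).  And in a chart
  \<open>\<phi>\<close> the two forms are given at a point by tensorial expressions: \<open>\<alpha>\<close> is the normal part of \<open>d\<^sup>2\<phi>\<close>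
  (\<open>sff_eq\<close>), and \<open>\<nabla>\<alpha>\<close> is the normal part of \<open>d\<^sup>3\<phi>\<close> corrected by three terms with Christoffel
  symbols (\<open>nabla_sff_eq\<close>), so neither depends on the chosen extensions of tangent vectors.
\<close>

section \<open>Calculus of smooth maps\<close>

text \<open>With the direction as first argument, derivatives iterate as
  \<open>d\<^sup>2f[h; k] = pd h (pd k f)\<close> and \<open>d\<^sup>3f[l; h; k] = pd l (pd h (pd k f))\<close>, the outermost direction being
  the last one differentiated.  Covariant derivatives and derivatives along curves produce their mixed
  terms with the directions in the same order, so the two can be compared term by term.\<close>
definition pd :: "'b::euclidean_space \<Rightarrow> ('b \<Rightarrow> 'c::real_normed_vector) \<Rightarrow> 'b \<Rightarrow> 'c" where
  "pd h f = (\<lambda>x. frechet_derivative f (at x) h)"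

lemma Ck_on_Suc_pd:
  "Ck_on (Suc k) f U \<longleftrightarrow> f differentiable_on U \<and> (\<forall>h. Ck_on k (pd h f) U)"
  by (simp add: pd_def)

declare Ck_on.simps(2) [simp del]

lemma pd_eqI: "(f has_derivative f') (at x) \<Longrightarrow> pd h f x = f' h"
  unfolding pd_def by (metis frechet_derivative_at)

lemma has_derivative_pd: "f differentiable at x \<Longrightarrow> (f has_derivative (\<lambda>h. pd h f x)) (at x)"
  unfolding pd_def by (simp add: frechet_derivative_works[symmetric])

lemma pd_cong_open:
  assumes "open U" "x \<in> U" "\<And>y. y \<in> U \<Longrightarrow> f y = g y" "f differentiable at x"
  shows "pd h f x = pd h g x"
  using frechet_derivative_transform_within_open[of f x U g] assms by (simp add: pd_def)

lemma Ck_on_Suc_differentiable: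
  assumes "open U" "Ck_on (Suc k) f U" "x \<in> U"
  shows "f differentiable at x"
  using assms by (meson Ck_on_Suc_pd differentiable_on_eq_differentiable_at)

lemma Ck_on_cong:
  assumes "open U" "\<And>x. x \<in> U \<Longrightarrow> f x = g x" "Ck_on k f U"
  shows "Ck_on k g U"
  using assms(2,3)
proof (induction k arbitrary: f g)
  case 0
  have "continuous_on U f" using 0(2) by simp
  then have "continuous_on U g" by (rule continuous_on_eq) (rule 0(1))
  then show ?case by simp
next
  case (Suc k)
  have d: "f differentiable at x" if "x \<in> U" for x
    using Ck_on_Suc_differentiable[OF \<open>open U\<close> Suc.prems(2) that] .
  have "g differentiable_on U"
    unfolding differentiable_on_eq_differentiable_at[OF \<open>open U\<close>]
  proof
    fix x assume "x \<in> U"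
    then show "g differentiable at x"
      using has_derivative_transform_within_open[OF has_derivative_pd[OF d] \<open>open U\<close>] Suc.prems(1)
      by (metis differentiable_def)
  qed
  moreover have "Ck_on k (pd h g) U" for h
  proof (rule Suc.IH)
    show "pd h f x = pd h g x" if "x \<in> U" for x
      by (rule pd_cong_open[OF \<open>open U\<close> that Suc.prems(1) d[OF that]])
    show "Ck_on k (pd h f) U" using Suc.prems(2) by (simp add: Ck_on_Suc_pd)
  qed
  ultimately show ?case by (simp add: Ck_on_Suc_pd)
qed

text \<open>The induction step of the closure properties below: the derivative may be given by any
  formula that is correct on the open set.\<close>
lemma Ck_on_SucI:
  assumes "open U" "\<And>x. x \<in> U \<Longrightarrow> (f has_derivative (\<lambda>h. f' h x)) (at x)"
    "\<And>h. Ck_on k (f' h) U"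
  shows "Ck_on (Suc k) f U"
proof -
  have "pd h f x = f' h x" if "x \<in> U" for h x
    using pd_eqI[OF assms(2)[OF that]] .
  then have "Ck_on k (pd h f) U" for h
    using Ck_on_cong[OF assms(1) _ assms(3)[of h], of "pd h f"] by simp
  moreover have "f differentiable_on U"
    using assms by (meson differentiable_def differentiable_on_eq_differentiable_at)
  ultimately show ?thesis by (simp add: Ck_on_Suc_pd)
qed

lemma Ck_on_has_derivative:
  assumes "open U" "Ck_on (Suc k) f U" "x \<in> U"
  shows "(f has_derivative (\<lambda>h. pd h f x)) (at x)"
  using Ck_on_Suc_differentiable[OF assms] by (rule has_derivative_pd)

lemma Ck_on_Suc_lower: "Ck_on (Suc k) f U \<Longrightarrow> Ck_on k f U"
proof (induction k arbitrary: f)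
  case 0
  then show ?case by (simp add: Ck_on_Suc_pd differentiable_imp_continuous_on)
next
  case (Suc k)
  then show ?case using Ck_on_Suc_pd by metis
qed

lemma Ck_on_subset: "Ck_on k f U \<Longrightarrow> V \<subseteq> U \<Longrightarrow> Ck_on k f V"
proof (induction k arbitrary: f)
  case 0
  then show ?case using continuous_on_subset by auto
next
  case (Suc k)
  then show ?case by (metis Ck_on_Suc_pd differentiable_on_subset)
qed

lemma Ck_on_const: "Ck_on k (\<lambda>x. c) U"
proof (induction k arbitrary: c)
  case (Suc k)
  have "pd h (\<lambda>x. c) = (\<lambda>x. 0)" for h :: 'a by (auto simp: pd_def)
  then have "Ck_on k (pd h (\<lambda>x. c)) U" for h
    using Suc[of 0] by simp
  then show ?case by (simp add: Ck_on_Suc_pd)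
qed simp

lemma Ck_on_add:
  assumes "open U" "Ck_on k f U" "Ck_on k g U"
  shows "Ck_on k (\<lambda>x. f x + g x) U"
  using assms(2,3)
proof (induction k arbitrary: f g)
  case 0
  then show ?case by (auto intro: continuous_intros)
next
  case (Suc k)
  show ?case
  proof (rule Ck_on_SucI[OF \<open>open U\<close>, where f' = "\<lambda>h x. pd h f x + pd h g x"])
    show "((\<lambda>x. f x + g x) has_derivative (\<lambda>h. pd h f x + pd h g x)) (at x)" if "x \<in> U" for x
      by (intro has_derivative_add Ck_on_has_derivative[OF \<open>open U\<close> _ that, where k = k] Suc.prems)
    show "Ck_on k (\<lambda>x. pd h f x + pd h g x) U" for h
      using Suc by (meson Ck_on_Suc_pd)
  qed
qed

lemma Ck_on_bilinear:
  assumes "bounded_bilinear B" "open U" "Ck_on k f U" "Ck_on k g U"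
  shows "Ck_on k (\<lambda>x. B (f x) (g x)) U"
  using assms(3,4)
proof (induction k arbitrary: f g)
  case 0
  then show ?case using bounded_bilinear.continuous_on[OF assms(1)] by simp
next
  case (Suc k)
  show ?case
  proof (rule Ck_on_SucI[OF \<open>open U\<close>, where f' = "\<lambda>h x. B (f x) (pd h g x) + B (pd h f x) (g x)"])
    show "((\<lambda>x. B (f x) (g x)) has_derivative (\<lambda>h. B (f x) (pd h g x) + B (pd h f x) (g x))) (at x)"
      if "x \<in> U" for x
      by (intro bounded_bilinear.FDERIV[OF assms(1)]
          Ck_on_has_derivative[OF \<open>open U\<close> _ that, where k = k] Suc.prems)
    have "Ck_on k f U" "Ck_on k g U"
      by (rule Ck_on_Suc_lower[OF Suc.prems(1)], rule Ck_on_Suc_lower[OF Suc.prems(2)])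
    then show "Ck_on k (\<lambda>x. B (f x) (pd h g x) + B (pd h f x) (g x)) U" for h
      by (intro Ck_on_add[OF \<open>open U\<close>] Suc.IH) (use Suc.prems in \<open>auto simp: Ck_on_Suc_pd\<close>)
  qed
qed

lemma Ck_on_bounded_linear:
  assumes "bounded_linear T" "open U" "Ck_on k f U"
  shows "Ck_on k (\<lambda>x. T (f x)) U"
  using assms(3)
proof (induction k arbitrary: f)
  case 0
  then show ?case using bounded_linear.continuous_on[OF assms(1)] by simp
next
  case (Suc k)
  show ?case
  proof (rule Ck_on_SucI[OF \<open>open U\<close>, where f' = "\<lambda>h x. T (pd h f x)"])
    show "((\<lambda>x. T (f x)) has_derivative (\<lambda>h. T (pd h f x))) (at x)" if "x \<in> U" for x
      by (intro bounded_linear.has_derivative[OF assms(1)]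
          Ck_on_has_derivative[OF \<open>open U\<close> _ that, where k = k] Suc.prems)
    show "Ck_on k (\<lambda>x. T (pd h f x)) U" for h
      using Suc by (meson Ck_on_Suc_pd)
  qed
qed

lemma Ck_on_sum:
  assumes "open U" "\<And>i. i \<in> I \<Longrightarrow> Ck_on k (f i) U"
  shows "Ck_on k (\<lambda>x. \<Sum>i\<in>I. f i x) U"
  using assms(2) 
  by (induction I rule: infinite_finite_induct) (auto simp: Ck_on_const Ck_on_add[OF \<open>open U\<close>])

lemma Ck_on_inverse:
  fixes f :: "'a::euclidean_space \<Rightarrow> real"
  assumes "open U" "Ck_on k f U" "\<And>x. x \<in> U \<Longrightarrow> f x \<noteq> 0"
  shows "Ck_on k (\<lambda>x. inverse (f x)) U"
  using assms(2)
proof (induction k)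
  case 0
  then show ?case using assms(3) by (auto intro: continuous_intros)
next
  case (Suc k)
  show ?case
  proof (rule Ck_on_SucI[OF \<open>open U\<close>, where f' = "\<lambda>h x. - (inverse (f x) * pd h f x * inverse (f x))"])
    show "((\<lambda>x. inverse (f x)) has_derivative (\<lambda>h. - (inverse (f x) * pd h f x * inverse (f x)))) (at x)"
      if "x \<in> U" for x
      using Deriv.has_derivative_inverse[OF assms(3)[OF that] Ck_on_has_derivative[OF \<open>open U\<close> Suc.prems that]] .
    have "Ck_on k (\<lambda>x. inverse (f x)) U"
      using Suc.IH[OF Ck_on_Suc_lower[OF Suc.prems]] .
    then have "Ck_on k (\<lambda>x. inverse (f x) * pd h f x * inverse (f x)) U" for h
      by (intro Ck_on_bilinear[OF bounded_bilinear_mult \<open>open U\<close>])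
        (use Suc.prems in \<open>auto simp: Ck_on_Suc_pd\<close>)
    then show "Ck_on k (\<lambda>x. - (inverse (f x) * pd h f x * inverse (f x))) U" for h
      using Ck_on_bounded_linear[OF bounded_linear_minus[OF bounded_linear_ident] \<open>open U\<close>] by blast
  qed
qed

lemma pd_linear: "f differentiable at x \<Longrightarrow> linear (\<lambda>h. pd h f x)"
  using has_derivative_linear[OF has_derivative_pd] .

lemma linear_basis_sum:
  fixes L :: "'a::euclidean_space \<Rightarrow> 'b::real_vector"
  assumes "linear L"
  shows "L h = (\<Sum>b\<in>Basis. (h \<bullet> b) *\<^sub>R L b)"
proof -
  have "L h = L (\<Sum>b\<in>Basis. (h \<bullet> b) *\<^sub>R b)" by (simp add: euclidean_representation)
  then show ?thesis by (simp add: linear_sum[OF assms] linear_scale[OF assms])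
qed

text \<open>In an orthonormal basis the chain rule writes the derivative of the composite as a sum of products
  of components of the derivative of \<open>f\<close> with composites of partial derivatives of \<open>g\<close>.  All of
  these are one class lower, so induction applies.\<close>
lemma Ck_on_compose:
  fixes f :: "'a::euclidean_space \<Rightarrow> 'b::euclidean_space" and g :: "'b \<Rightarrow> 'c::real_normed_vector"
  assumes "open U" "open V" "Ck_on k f U" "Ck_on k g V" "f ` U \<subseteq> V"
  shows "Ck_on k (\<lambda>x. g (f x)) U"
  using assms(3,4)
proof (induction k arbitrary: g)
  case 0
  then show ?case using continuous_on_compose2 assms(5) by auto
next
  case (Suc k)
  have fV: "f x \<in> V" if "x \<in> U" for x using that assms(5) by auto
  show ?case
  proof (rule Ck_on_SucI[OF \<open>open U\<close>,
        where f' = "\<lambda>h x. \<Sum>b\<in>Basis. (pd h f x \<bullet> b) *\<^sub>R pd b g (f x)"])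
    fix x assume x: "x \<in> U"
    have D: "((\<lambda>x. g (f x)) has_derivative (\<lambda>h. pd (pd h f x) g (f x))) (at x)"
      using has_derivative_compose[OF Ck_on_has_derivative[OF \<open>open U\<close> Suc.prems(1) x]
          Ck_on_has_derivative[OF \<open>open V\<close> Suc.prems(2) fV[OF x]]] .
    have eq: "pd (pd h f x) g (f x) = (\<Sum>b\<in>Basis. (pd h f x \<bullet> b) *\<^sub>R pd b g (f x))" for h
      by (rule linear_basis_sum[OF pd_linear])
         (rule Ck_on_Suc_differentiable[OF \<open>open V\<close> Suc.prems(2) fV[OF x]])
    from D show "((\<lambda>x. g (f x)) has_derivative
        (\<lambda>h. \<Sum>b\<in>Basis. (pd h f x \<bullet> b) *\<^sub>R pd b g (f x))) (at x)"
      by (rule has_derivative_eq_rhs) (rule ext, rule eq)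
  next
    fix h
    have k: "Ck_on k f U" using Suc.prems(1) by (rule Ck_on_Suc_lower)
    have "Ck_on k (\<lambda>x. pd b g (f x)) U" for b
      by (rule Suc.IH[OF k]) (use Suc.prems(2) in \<open>simp add: Ck_on_Suc_pd\<close>)
    moreover have "Ck_on k (\<lambda>x. pd h f x \<bullet> b) U" for b
      by (rule Ck_on_bounded_linear[OF bounded_linear_inner_left \<open>open U\<close>])
         (use Suc.prems in \<open>simp add: Ck_on_Suc_pd\<close>)
    ultimately show "Ck_on k (\<lambda>x. \<Sum>b\<in>Basis. (pd h f x \<bullet> b) *\<^sub>R pd b g (f x)) U"
      by (intro Ck_on_sum[OF \<open>open U\<close>] Ck_on_bilinear[OF bounded_bilinear_scaleR \<open>open U\<close>]) auto
  qed
qed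

lemma smooth_on_cong:
  "open U \<Longrightarrow> (\<And>x. x \<in> U \<Longrightarrow> f x = g x) \<Longrightarrow> smooth_on U f \<Longrightarrow> smooth_on U g"
  unfolding smooth_on_def
proof
  fix k assume "open U" "\<And>x. x \<in> U \<Longrightarrow> f x = g x" "\<forall>k. Ck_on k f U"
  then show "Ck_on k g U" using Ck_on_cong[of U f g k] by simp
qed

lemma smooth_on_subset: "smooth_on U f \<Longrightarrow> V \<subseteq> U \<Longrightarrow> smooth_on V f"
  unfolding smooth_on_def using Ck_on_subset by blast

lemma smooth_on_differentiable: "open U \<Longrightarrow> smooth_on U f \<Longrightarrow> x \<in> U \<Longrightarrow> f differentiable at x"
  using Ck_on_Suc_differentiable[of U 0 f x] by (simp add: smooth_on_def)

lemma smooth_on_continuous: "smooth_on U f \<Longrightarrow> continuous_on U f"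
  unfolding smooth_on_def by (metis Ck_on.simps(1))

lemma smooth_on_has_derivative:
  "open U \<Longrightarrow> smooth_on U f \<Longrightarrow> x \<in> U \<Longrightarrow> (f has_derivative (\<lambda>h. pd h f x)) (at x)"
  using Ck_on_has_derivative[of U 0 f x] by (simp add: smooth_on_def)

lemma smooth_on_pd: "smooth_on U f \<Longrightarrow> smooth_on U (pd h f)"
  unfolding smooth_on_def by (meson Ck_on_Suc_pd)

lemma smooth_on_const: "smooth_on U (\<lambda>x. c)"
  by (simp add: smooth_on_def Ck_on_const)

lemma smooth_on_add:
  "open U \<Longrightarrow> smooth_on U f \<Longrightarrow> smooth_on U g \<Longrightarrow> smooth_on U (\<lambda>x. f x + g x)"
  by (simp add: smooth_on_def Ck_on_add)

lemma smooth_on_bounded_linear: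
  "bounded_linear T \<Longrightarrow> open U \<Longrightarrow> smooth_on U f \<Longrightarrow> smooth_on U (\<lambda>x. T (f x))"
  by (simp add: smooth_on_def Ck_on_bounded_linear)

lemma smooth_on_diff:
  assumes "open U" "smooth_on U f" "smooth_on U g"
  shows "smooth_on U (\<lambda>x. f x - g x)"
  using smooth_on_add[OF assms(1,2)
      smooth_on_bounded_linear[OF bounded_linear_minus[OF bounded_linear_ident] assms(1,3)]]
  by simp

lemma smooth_on_bilinear:
  "bounded_bilinear B \<Longrightarrow> open U \<Longrightarrow> smooth_on U f \<Longrightarrow> smooth_on U g
    \<Longrightarrow> smooth_on U (\<lambda>x. B (f x) (g x))"
  by (simp add: smooth_on_def Ck_on_bilinear)

lemmas smooth_on_scaleR = smooth_on_bilinear[OF bounded_bilinear_scaleR]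
lemmas smooth_on_inner = smooth_on_bilinear[OF bounded_bilinear_inner]
lemmas smooth_on_mult = smooth_on_bilinear[OF bounded_bilinear_mult]

lemma smooth_on_sum:
  "open U \<Longrightarrow> (\<And>i. i \<in> I \<Longrightarrow> smooth_on U (f i)) \<Longrightarrow> smooth_on U (\<lambda>x. \<Sum>i\<in>I. f i x)"
  by (simp add: smooth_on_def Ck_on_sum)

lemma smooth_on_divide:
  fixes f g :: "'a::euclidean_space \<Rightarrow> real"
  assumes "open U" "smooth_on U f" "smooth_on U g" "\<And>x. x \<in> U \<Longrightarrow> g x \<noteq> 0"
  shows "smooth_on U (\<lambda>x. f x / g x)"
proof -
  have "smooth_on U (\<lambda>x. inverse (g x))"
    using assms by (simp add: smooth_on_def Ck_on_inverse)
  then show ?thesis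
    using smooth_on_mult[OF assms(1,2)] by (simp add: divide_inverse)
qed

lemma smooth_on_compose:
  fixes f :: "'a::euclidean_space \<Rightarrow> 'b::euclidean_space" and g :: "'b \<Rightarrow> 'c::real_normed_vector"
  assumes "open U" "open V" "smooth_on U f" "smooth_on V g" "f ` U \<subseteq> V"
  shows "smooth_on U (\<lambda>x. g (f x))"
  unfolding smooth_on_def
proof
  show "Ck_on k (\<lambda>x. g (f x)) U" for k
    using assms Ck_on_compose[of U V k f g] by (simp add: smooth_on_def)
qed

lemma smooth_on_pd_along:
  fixes z :: "'a::euclidean_space \<Rightarrow> 'b::euclidean_space"
  assumes "open V" "open U" "smooth_on U f" "smooth_on V z" "z ` V \<subseteq> U" "smooth_on V w"
  shows "smooth_on V (\<lambda>s. pd (w s) f (z s))"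
proof -
  have "smooth_on V (\<lambda>s. \<Sum>b\<in>Basis. (w s \<bullet> b) *\<^sub>R pd b f (z s))"
    by (intro smooth_on_sum smooth_on_scaleR smooth_on_inner smooth_on_const assms
        smooth_on_compose[OF assms(1,2,4) _ assms(5)] smooth_on_pd)
  moreover have "(\<Sum>b\<in>Basis. (w s \<bullet> b) *\<^sub>R pd b f (z s)) = pd (w s) f (z s)" if "s \<in> V" for s
    by (rule linear_basis_sum[OF pd_linear, symmetric])
       (use assms that in \<open>auto intro: smooth_on_differentiable\<close>)
  ultimately show ?thesis
    using smooth_on_cong[OF \<open>open V\<close>, of "\<lambda>s. \<Sum>b\<in>Basis. (w s \<bullet> b) *\<^sub>R pd b f (z s)"] by simp
qed

lemma smooth_on_ident: "open U \<Longrightarrow> smooth_on U (\<lambda>x. x)"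
  unfolding smooth_on_def
proof
  fix k assume "open U"
  then show "Ck_on k (\<lambda>x. x) U"
  proof (cases k)
    case (Suc l)
    have "Ck_on (Suc l) (\<lambda>x. x) U"
      by (rule Ck_on_SucI[OF \<open>open U\<close> has_derivative_ident Ck_on_const])
    then show ?thesis by (simp only: Suc)
  qed simp
qed

text \<open>Product rule for \<open>L\<^sub>s(w\<^sub>s)\<close>.  In finite dimension it is enough that \<open>s \<mapsto> L\<^sub>s k\<close> is differentiable for
  each fixed \<open>k\<close>, since \<open>L\<^sub>s(w\<^sub>s)\<close> is a finite sum over a basis; this avoids the norm topology on
  linear maps.\<close>
lemma has_derivative_linear_family:
  fixes L :: "'a::real_normed_vector \<Rightarrow> 'b::euclidean_space \<Rightarrow> 'c::real_normed_vector"
  assumes lin: "\<forall>\<^sub>F s' in nhds s. linear (L s')"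
    and L: "\<And>k. ((\<lambda>s. L s k) has_derivative (\<lambda>h. L' h k)) (at s)"
    and w: "(w has_derivative w') (at s)"
  shows "((\<lambda>s. L s (w s)) has_derivative (\<lambda>h. L' h (w s) + L s (w' h))) (at s)"
proof -
  have lins: "linear (L s)"
    using lin eventually_nhds_x_imp_x by blast
  have ev: "\<forall>\<^sub>F s' in at s. (\<Sum>b\<in>Basis. (k s' \<bullet> b) *\<^sub>R L s' b) = L s' (k s')" for k
    using lin unfolding eventually_at_filter
    by eventually_elim (simp add: linear_basis_sum[symmetric])
  have sums: "((\<lambda>s. L s (k s)) has_derivative
      (\<lambda>h. (\<Sum>b\<in>Basis. (k s \<bullet> b) *\<^sub>R L' h b) + L s (k' h))) (at s)"
    if "(k has_derivative k') (at s)" for k k'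
  proof -
    have "((\<lambda>s. \<Sum>b\<in>Basis. (k s \<bullet> b) *\<^sub>R L s b) has_derivative
        (\<lambda>h. \<Sum>b\<in>Basis. (k s \<bullet> b) *\<^sub>R L' h b + (k' h \<bullet> b) *\<^sub>R L s b)) (at s)"
      by (intro has_derivative_sum has_derivative_scaleR has_derivative_inner_left that L)
    moreover have "(\<Sum>b\<in>Basis. (k s \<bullet> b) *\<^sub>R L' h b + (k' h \<bullet> b) *\<^sub>R L s b)
        = (\<Sum>b\<in>Basis. (k s \<bullet> b) *\<^sub>R L' h b) + L s (k' h)" for h
      using linear_basis_sum[OF lins, of "k' h"] by (simp add: sum.distrib)
    ultimately have "((\<lambda>s. \<Sum>b\<in>Basis. (k s \<bullet> b) *\<^sub>R L s b) has_derivative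
        (\<lambda>h. (\<Sum>b\<in>Basis. (k s \<bullet> b) *\<^sub>R L' h b) + L s (k' h))) (at s)"
      by (simp only:)
    then show ?thesis
      by (rule has_derivative_transform_eventually[OF _ ev[of k]])
        (simp_all only: linear_basis_sum[OF lins, symmetric] UNIV_I)
  qed
  have "(\<Sum>b\<in>Basis. (w s \<bullet> b) *\<^sub>R L' h b) = L' h (w s)" for h
  proof -
    have "((\<lambda>s'. L s' (w s)) has_derivative (\<lambda>h. (\<Sum>b\<in>Basis. (w s \<bullet> b) *\<^sub>R L' h b) + L s 0)) (at s)"
      using sums[OF has_derivative_const] .
    from has_derivative_unique[OF L[of "w s"] this] show ?thesis
      using linear_0[OF lins] by (metis add.right_neutral)
  qed
  then show ?thesis using sums[OF w] by simp
qed

lemma eventually_in_open_has_derivative: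
  assumes "(z has_derivative z') (at s)" "open U" "z s \<in> U"
  shows "\<forall>\<^sub>F s' in nhds s. z s' \<in> U"
proof -
  have "(z \<longlongrightarrow> z s) (nhds s)"
    using has_derivative_continuous[OF assms(1)]
    by (simp add: continuous_at tendsto_at_iff_tendsto_nhds)
  then show ?thesis using topological_tendstoD[OF _ assms(2,3)] by blast
qed

text \<open>The parameter \<open>s\<close> ranges over any normed space, so that the same rule serves for vector fields
  (\<open>z\<close> the identity of the parameter plane) and for curves (\<open>s\<close> the time).\<close>
lemma has_derivative_pd_along:
  fixes z :: "'s::real_normed_vector \<Rightarrow> 'a::euclidean_space"
  assumes "open U" "smooth_on U f" "z s \<in> U"
    and z: "(z has_derivative z') (at s)" and w: "(w has_derivative w') (at s)"
  shows "((\<lambda>s. pd (w s) f (z s)) has_derivative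
      (\<lambda>h. pd (z' h) (pd (w s) f) (z s) + pd (w' h) f (z s))) (at s)"
proof (rule has_derivative_linear_family[OF _ _ w, where L = "\<lambda>s k. pd k f (z s)"])
  have "\<forall>\<^sub>F s' in nhds s. z s' \<in> U"
    by (rule eventually_in_open_has_derivative[OF z assms(1,3)])
  then show "\<forall>\<^sub>F s' in nhds s. linear (\<lambda>k. pd k f (z s'))"
    by eventually_elim (use assms smooth_on_differentiable in \<open>blast intro: pd_linear\<close>)
  show "((\<lambda>s. pd k f (z s)) has_derivative (\<lambda>h. pd (z' h) (pd k f) (z s))) (at s)" for k
    by (intro has_derivative_compose[OF z] smooth_on_has_derivative[OF assms(1)] smooth_on_pd assms)
qed

lemma linear_pd_pd:
  assumes "open U" "smooth_on U f" "x \<in> U"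
  shows "linear (\<lambda>k. pd h (pd k f) x)"
proof -
  have lin: "linear (\<lambda>k. pd k f y)" if "y \<in> U" for y
    using that assms smooth_on_differentiable pd_linear by blast
  have d: "(pd k f has_derivative (\<lambda>h. pd h (pd k f) x)) (at x)" for k
    using assms smooth_on_has_derivative smooth_on_pd by blast
  show ?thesis
  proof
    fix k l :: 'a and r :: real
    have "((\<lambda>y. pd k f y + pd l f y) has_derivative (\<lambda>h. pd h (pd k f) x + pd h (pd l f) x)) (at x)"
      by (intro has_derivative_add d)
    then have "(pd (k + l) f has_derivative (\<lambda>h. pd h (pd k f) x + pd h (pd l f) x)) (at x)"
      by (rule has_derivative_transform_within_open[OF _ assms(1,3)])
        (simp add: linear_add[OF lin])
    then show "pd h (pd (k + l) f) x = pd h (pd k f) x + pd h (pd l f) x"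
      by (rule pd_eqI)
    have "((\<lambda>y. r *\<^sub>R pd k f y) has_derivative (\<lambda>h. r *\<^sub>R pd h (pd k f) x)) (at x)"
      by (intro has_derivative_scaleR_right d)
    then have "(pd (r *\<^sub>R k) f has_derivative (\<lambda>h. r *\<^sub>R pd h (pd k f) x)) (at x)"
      by (rule has_derivative_transform_within_open[OF _ assms(1,3)])
        (simp add: linear_scale[OF lin])
    then show "pd h (pd (r *\<^sub>R k) f) x = r *\<^sub>R pd h (pd k f) x"
      by (rule pd_eqI)
  qed
qed

lemma smooth_on_pd_pd_along:
  fixes z :: "'a::euclidean_space \<Rightarrow> 'b::euclidean_space"
  assumes "open V" "open U" "smooth_on U f" "smooth_on V z" "z ` V \<subseteq> U" "smooth_on V w1" "smooth_on V w2"
  shows "smooth_on V (\<lambda>s. pd (w1 s) (pd (w2 s) f) (z s))"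
proof -
  have "smooth_on V (\<lambda>s. \<Sum>b\<in>Basis. (w2 s \<bullet> b) *\<^sub>R pd (w1 s) (pd b f) (z s))"
    by (intro smooth_on_sum smooth_on_scaleR smooth_on_inner smooth_on_const assms
        smooth_on_pd_along[OF assms(1,2) _ assms(4,5)] smooth_on_pd)
  moreover have "(\<Sum>b\<in>Basis. (w2 s \<bullet> b) *\<^sub>R pd (w1 s) (pd b f) (z s)) = pd (w1 s) (pd (w2 s) f) (z s)"
    if "s \<in> V" for s
    by (rule linear_basis_sum[OF linear_pd_pd[OF assms(2,3)], symmetric])
       (use assms that in auto)
  ultimately show ?thesis
    using smooth_on_cong[OF \<open>open V\<close>,
        of "\<lambda>s. \<Sum>b\<in>Basis. (w2 s \<bullet> b) *\<^sub>R pd (w1 s) (pd b f) (z s)"] by simp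
qed

lemma has_derivative_pd_pd_along:
  fixes z :: "'s::real_normed_vector \<Rightarrow> 'a::euclidean_space"
  assumes "open U" "smooth_on U f" "z s \<in> U"
    and z: "(z has_derivative z') (at s)"
    and w1: "(w1 has_derivative w1') (at s)" and w2: "(w2 has_derivative w2') (at s)"
  shows "((\<lambda>s. pd (w1 s) (pd (w2 s) f) (z s)) has_derivative
      (\<lambda>h. pd (z' h) (pd (w1 s) (pd (w2 s) f)) (z s) + pd (w1' h) (pd (w2 s) f) (z s)
        + pd (w1 s) (pd (w2' h) f) (z s))) (at s)"
proof (rule has_derivative_linear_family[OF _ _ w2, where L = "\<lambda>s k. pd (w1 s) (pd k f) (z s)"])
  have "\<forall>\<^sub>F s' in nhds s. z s' \<in> U"
    by (rule eventually_in_open_has_derivative[OF z assms(1,3)])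
  then show "\<forall>\<^sub>F s' in nhds s. linear (\<lambda>k. pd (w1 s') (pd k f) (z s'))"
    by eventually_elim (rule linear_pd_pd[OF assms(1,2)])
  show "((\<lambda>s. pd (w1 s) (pd k f) (z s)) has_derivative
      (\<lambda>h. pd (z' h) (pd (w1 s) (pd k f)) (z s) + pd (w1' h) (pd k f) (z s))) (at s)" for k
    by (rule has_derivative_pd_along[OF assms(1) _ assms(3) z w1]) (intro smooth_on_pd assms)
qed

section \<open>An immersed surface in a chart\<close>

lemma vec2_decomp: "(h :: real^2) = (h $ 1) *\<^sub>R axis 1 1 + (h $ 2) *\<^sub>R axis 2 1"
  by (simp add: vec_eq_iff forall_2 axis_def)

text \<open>All objects of the theorem are attached to one point, so a single local parametrization around it
  suffices.  In its image everything is expressed by \<open>\<phi> = F \<circ> x\<close> and its derivatives.\<close>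
locale surface_chart =
  fixes A :: "'a::{t2_space,second_countable_topology} atlas" and F :: "'a \<Rightarrow> real^4"
    and U :: "(real^2) set" and x :: "real^2 \<Rightarrow> 'a"
  assumes immersed: "immersed_surface A F" and chart: "(U, x) \<in> A"
begin

abbreviation \<phi> :: "real^2 \<Rightarrow> real^4" where "\<phi> \<equiv> F \<circ> x"

lemma chart_facts:
  assumes "(V, y) \<in> A"
  shows "open V" "open (y ` V)" "continuous_on V y" "inj_on y V" "continuous_on (y ` V) (inv_into V y)"
    and "smooth_on V (F \<circ> y)"
proof -
  from immersed assms have h: "open V" "open (y ` V)" "homeomorphism V (y ` V) y (inv_into V y)"
    "smooth_on V (F \<circ> y)"
    by (auto simp: immersed_surface_def surface_atlas_def)
  then show "open V" "open (y ` V)" "continuous_on V y" "continuous_on (y ` V) (inv_into V y)"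
    "smooth_on V (F \<circ> y)"
    by (auto simp: homeomorphism_def)
  show "inj_on y V" using h(3) by (metis homeomorphism_def inj_on_inverseI)
qed

lemmas open_U = chart_facts(1)[OF chart]
  and open_image = chart_facts(2)[OF chart]
  and cont_x = chart_facts(3)[OF chart]
  and inj_x = chart_facts(4)[OF chart]
  and cont_inv_x = chart_facts(5)[OF chart]
  and smooth_phi = chart_facts(6)[OF chart]

lemma inv_x [simp]: "u \<in> U \<Longrightarrow> inv_into U x (x u) = u"
  using inj_x by simp

lemma transition_smooth:
  "(V, y) \<in> A \<Longrightarrow> (V', y') \<in> A \<Longrightarrow> smooth_on {u \<in> V. y u \<in> y' ` V'} (inv_into V' y' \<circ> y)"
  using immersed by (fastforce simp: immersed_surface_def surface_atlas_def)

lemma open_chart_preimage: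
  assumes "(V, y) \<in> A" "open W"
  shows "open {u \<in> V. y u \<in> W}"
proof -
  have "open (V \<inter> y -` W)"
    using continuous_open_preimage[OF chart_facts(3,1)[OF assms(1)] assms(2)] .
  then show ?thesis by (simp add: Int_def)
qed

lemma inj_dphi: "u \<in> U \<Longrightarrow> pd h \<phi> u = pd k \<phi> u \<longleftrightarrow> h = k"
  using immersed chart by (fastforce simp: immersed_surface_def pd_def inj_def)

lemma linear_dphi: "u \<in> U \<Longrightarrow> linear (\<lambda>h. pd h \<phi> u)"
  by (rule pd_linear[OF smooth_on_differentiable[OF open_U smooth_phi]])

text \<open>One linear map \<open>T\<close>, the differential of the transition map, relates the derivatives of \<^emph>\<open>every\<close> map
  on the surface in the two charts.  Applied to the immersion and to a vector field simultaneously
  it yields the chart independence of tangent planes and of directional derivatives.\<close>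
lemma chart_change:
  assumes "(V, y) \<in> A" "u' \<in> V" "u \<in> U" "y u' = x u"
  obtains T where "\<And>(G :: 'a \<Rightarrow> real^4) g. ((G \<circ> x) has_derivative g) (at u)
      \<Longrightarrow> ((G \<circ> y) has_derivative (\<lambda>h. g (T h))) (at u')"
proof -
  let ?\<tau> = "inv_into U x \<circ> y" and ?S = "{w \<in> V. y w \<in> x ` U}"
  have S: "open ?S" "u' \<in> ?S"
    using open_chart_preimage[OF assms(1) open_image] assms by auto
  have \<tau>: "(?\<tau> has_derivative (\<lambda>h. pd h ?\<tau> u')) (at u')"
    by (rule smooth_on_has_derivative[OF S(1) transition_smooth[OF assms(1) chart] S(2)])
  have \<tau>u: "?\<tau> u' = u" using assms by simp
  have "((G \<circ> y) has_derivative (\<lambda>h. g (pd h ?\<tau> u'))) (at u')"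
    if "((G \<circ> x) has_derivative g) (at u)" for G :: "'a \<Rightarrow> real^4" and g
  proof (rule has_derivative_transform_within_open[OF _ S])
    show "((\<lambda>w. (G \<circ> x) (?\<tau> w)) has_derivative (\<lambda>h. g (pd h ?\<tau> u'))) (at u')"
      using has_derivative_compose[OF \<tau>, of "G \<circ> x" g] that \<tau>u by simp
    show "(G \<circ> x) (?\<tau> w) = (G \<circ> y) w" if "w \<in> ?S" for w
      using that by (auto simp: f_inv_into_f)
  qed
  then show ?thesis using that[of "\<lambda>h. pd h ?\<tau> u'"] by blast
qed

lemma tangent_plane_eq:
  assumes "u \<in> U"
  shows "tangent_plane A F (x u) = range (\<lambda>h. pd h \<phi> u)"
proof
  show "range (\<lambda>h. pd h \<phi> u) \<subseteq> tangent_plane A F (x u)"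
    using chart assms by (auto simp: tangent_plane_def pd_def)
  show "tangent_plane A F (x u) \<subseteq> range (\<lambda>h. pd h \<phi> u)"
  proof
    fix w assume "w \<in> tangent_plane A F (x u)"
    then obtain V y u' h where h: "(V, y) \<in> A" "u' \<in> V" "y u' = x u" "w = pd h (F \<circ> y) u'"
      by (auto simp: tangent_plane_def pd_def)
    obtain T where T: "\<And>(G :: 'a \<Rightarrow> real^4) g. ((G \<circ> x) has_derivative g) (at u)
      \<Longrightarrow> ((G \<circ> y) has_derivative (\<lambda>h. g (T h))) (at u')"
      using chart_change[OF h(1,2) assms h(3)] by blast
    have "pd h (F \<circ> y) u' = pd (T h) \<phi> u"
      using pd_eqI[OF T[OF smooth_on_has_derivative[OF open_U smooth_phi assms]]] .
    then show "w \<in> range (\<lambda>h. pd h \<phi> u)" using h(4) by simp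
  qed
qed

lemma normal_plane_iff:
  assumes "u \<in> U"
  shows "n \<in> normal_plane A F (x u) \<longleftrightarrow> (\<forall>h. n \<bullet> pd h \<phi> u = 0)"
  unfolding normal_plane_def orthogonal_comp_def tangent_plane_eq[OF assms]
  by (auto simp: orthogonal_def inner_commute)

lemma dir_deriv_eq:
  assumes "u \<in> U" "(Y \<circ> x) differentiable at u"
  shows "dir_deriv A F (x u) (pd h \<phi> u) Y = pd h (Y \<circ> x) u"
  unfolding dir_deriv_def
proof (rule the_equality)
  show "\<exists>V y u' k. (V, y) \<in> A \<and> u' \<in> V \<and> y u' = x u \<and>
      pd h \<phi> u = frechet_derivative (F \<circ> y) (at u') k \<and>
      pd h (Y \<circ> x) u = frechet_derivative (Y \<circ> y) (at u') k"
    using chart assms(1) by (auto simp: pd_def)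
next
  fix D assume "\<exists>V y u' k. (V, y) \<in> A \<and> u' \<in> V \<and> y u' = x u \<and>
      pd h \<phi> u = frechet_derivative (F \<circ> y) (at u') k \<and>
      D = frechet_derivative (Y \<circ> y) (at u') k"
  then obtain V y u' k where h: "(V, y) \<in> A" "u' \<in> V" "y u' = x u"
      "pd h \<phi> u = pd k (F \<circ> y) u'" "D = pd k (Y \<circ> y) u'"
    by (auto simp: pd_def)
  obtain T where T: "\<And>(G :: 'a \<Rightarrow> real^4) g. ((G \<circ> x) has_derivative g) (at u)
      \<Longrightarrow> ((G \<circ> y) has_derivative (\<lambda>h. g (T h))) (at u')"
    using chart_change[OF h(1,2) assms(1) h(3)] by blast
  have "pd k (F \<circ> y) u' = pd (T k) \<phi> u"
    using pd_eqI[OF T[OF smooth_on_has_derivative[OF open_U smooth_phi assms(1)]]] .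
  then have "h = T k" using h(4) inj_dphi[OF assms(1)] by simp
  then show "D = pd h (Y \<circ> x) u"
    using pd_eqI[OF T[OF has_derivative_pd[OF assms(2)]]] h(5) by simp
qed

subsection \<open>Tangential projection\<close>

text \<open>The Gram determinant of the coordinate basis, and Cramer's rule for the coordinates of the
  orthogonal projection to the tangent plane.  The explicit formulas make it evident that the
  projection depends smoothly on the point.\<close>
definition gram :: "real^2 \<Rightarrow> real" where
  "gram u = (pd (axis 1 1) \<phi> u \<bullet> pd (axis 1 1) \<phi> u) * (pd (axis 2 1) \<phi> u \<bullet> pd (axis 2 1) \<phi> u)
     - (pd (axis 1 1) \<phi> u \<bullet> pd (axis 2 1) \<phi> u) * (pd (axis 1 1) \<phi> u \<bullet> pd (axis 2 1) \<phi> u)"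

definition tan_coord :: "real^2 \<Rightarrow> real^4 \<Rightarrow> real^2" where
  "tan_coord u w =
     (((pd (axis 2 1) \<phi> u \<bullet> pd (axis 2 1) \<phi> u) * (w \<bullet> pd (axis 1 1) \<phi> u)
        - (pd (axis 1 1) \<phi> u \<bullet> pd (axis 2 1) \<phi> u) * (w \<bullet> pd (axis 2 1) \<phi> u)) / gram u) *\<^sub>R axis 1 1
   + (((pd (axis 1 1) \<phi> u \<bullet> pd (axis 1 1) \<phi> u) * (w \<bullet> pd (axis 2 1) \<phi> u)
        - (pd (axis 1 1) \<phi> u \<bullet> pd (axis 2 1) \<phi> u) * (w \<bullet> pd (axis 1 1) \<phi> u)) / gram u) *\<^sub>R axis 2 1"

lemma dphi_expand:
  assumes "u \<in> U"
  shows "pd h \<phi> u = (h $ 1) *\<^sub>R pd (axis 1 1) \<phi> u + (h $ 2) *\<^sub>R pd (axis 2 1) \<phi> u"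
  using arg_cong[OF vec2_decomp[of h], of "\<lambda>h. pd h \<phi> u"]
  by (simp only: linear_add[OF linear_dphi[OF assms]] linear_scale[OF linear_dphi[OF assms]])

text \<open>Equality in the Cauchy-Schwarz inequality would make the two coordinate vectors dependent,
  against the injectivity of the differential.\<close>
lemma gram_nonzero:
  assumes "u \<in> U"
  shows "gram u \<noteq> 0"
proof
  define P Q where "P = pd (axis 1 1) \<phi> u" and "Q = pd (axis 2 1) \<phi> u"
  assume "gram u = 0"
  then have g: "(P \<bullet> P) * (Q \<bullet> Q) = (P \<bullet> Q) * (P \<bullet> Q)" by (simp add: gram_def P_def Q_def)
  let ?R = "(P \<bullet> P) *\<^sub>R Q - (P \<bullet> Q) *\<^sub>R P"
  have "?R \<bullet> ?R = (P \<bullet> P) * ((P \<bullet> P) * (Q \<bullet> Q) - (P \<bullet> Q) * (P \<bullet> Q))"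
    by (simp add: inner_diff_left inner_diff_right inner_commute algebra_simps)
  then have "?R = 0" using g by simp
  moreover have "?R = pd (vector [- (P \<bullet> Q), P \<bullet> P]) \<phi> u"
    by (subst dphi_expand[OF assms]) (simp add: P_def Q_def)
  moreover have "pd 0 \<phi> u = 0" using linear_0[OF linear_dphi[OF assms]] .
  ultimately have "(vector [- (P \<bullet> Q), P \<bullet> P] :: real^2) = 0"
    using inj_dphi[OF assms] by metis
  then have "P \<bullet> P = 0" by (metis vector_2(2) zero_index)
  then have "pd (axis 1 1) \<phi> u = pd 0 \<phi> u" using \<open>pd 0 \<phi> u = 0\<close> by (simp add: P_def)
  then show False using inj_dphi[OF assms] by (metis axis_eq_0_iff zero_neq_one)
qed

lemma tan_coord_orthogonal:
  assumes "u \<in> U"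
  shows "(w - pd (tan_coord u w) \<phi> u) \<bullet> pd h \<phi> u = 0"
proof -
  define P Q where "P = pd (axis 1 1) \<phi> u" and "Q = pd (axis 2 1) \<phi> u"
  define E where "E = P \<bullet> P"
  define M where "M = P \<bullet> Q"
  define N where "N = Q \<bullet> Q"
  have g: "E * N - M * M \<noteq> 0"
    using gram_nonzero[OF assms] by (simp add: gram_def P_def Q_def E_def M_def N_def)
  have t: "pd (tan_coord u w) \<phi> u = ((N * (w \<bullet> P) - M * (w \<bullet> Q)) / (E * N - M * M)) *\<^sub>R P
      + ((E * (w \<bullet> Q) - M * (w \<bullet> P)) / (E * N - M * M)) *\<^sub>R Q"
    by (subst dphi_expand[OF assms])
      (simp add: tan_coord_def gram_def P_def Q_def E_def M_def N_def axis_def)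
  have "(w - pd (tan_coord u w) \<phi> u) \<bullet> P
      = w \<bullet> P - ((N * (w \<bullet> P) - M * (w \<bullet> Q)) / (E * N - M * M)) * E
        - ((E * (w \<bullet> Q) - M * (w \<bullet> P)) / (E * N - M * M)) * M"
    unfolding t by (simp add: inner_diff_left inner_add_left E_def M_def inner_commute[of Q P])
  also have "\<dots> = 0" using g by (simp add: field_simps)
  finally have 1: "(w - pd (tan_coord u w) \<phi> u) \<bullet> P = 0" .
  have "(w - pd (tan_coord u w) \<phi> u) \<bullet> Q
      = w \<bullet> Q - ((N * (w \<bullet> P) - M * (w \<bullet> Q)) / (E * N - M * M)) * M
        - ((E * (w \<bullet> Q) - M * (w \<bullet> P)) / (E * N - M * M)) * N"
    unfolding t by (simp add: inner_diff_left inner_add_left N_def M_def)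
  also have "\<dots> = 0" using g by (simp add: field_simps)
  finally have 2: "(w - pd (tan_coord u w) \<phi> u) \<bullet> Q = 0" .
  show ?thesis
    using 1 2 by (subst dphi_expand[OF assms, of h]) (simp add: inner_add_right P_def Q_def)
qed

lemma tangent_normal_unique:
  assumes "u \<in> U" "\<And>h. (w - pd k \<phi> u) \<bullet> pd h \<phi> u = 0"
  shows "k = tan_coord u w"
proof -
  have "(w - pd k \<phi> u - (w - pd (tan_coord u w) \<phi> u)) \<bullet> pd h \<phi> u = 0" for h
    using assms(2) tan_coord_orthogonal[OF assms(1)] by (simp only: inner_diff_left)
  then have *: "(pd (tan_coord u w) \<phi> u - pd k \<phi> u) \<bullet> pd h \<phi> u = 0" for h
    by (simp add: algebra_simps)
  have "pd (tan_coord u w - k) \<phi> u = pd (tan_coord u w) \<phi> u - pd k \<phi> u"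
    by (rule linear_diff[OF linear_dphi[OF assms(1)]])
  then have "pd (tan_coord u w) \<phi> u - pd k \<phi> u = 0"
    using *[of "tan_coord u w - k"] by simp
  then show ?thesis using inj_dphi[OF assms(1)] by (metis eq_iff_diff_eq_0)
qed

lemma tan_part_eq:
  assumes "u \<in> U"
  shows "tan_part A F (x u) w = pd (tan_coord u w) \<phi> u"
  unfolding tan_part_def
proof (rule the_equality)
  show "pd (tan_coord u w) \<phi> u \<in> tangent_plane A F (x u) \<and>
      w - pd (tan_coord u w) \<phi> u \<in> normal_plane A F (x u)"
    by (simp add: tangent_plane_eq[OF assms] normal_plane_iff[OF assms] tan_coord_orthogonal[OF assms])
  fix Y assume Y: "Y \<in> tangent_plane A F (x u) \<and> w - Y \<in> normal_plane A F (x u)"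
  then obtain k where k: "Y = pd k \<phi> u" using tangent_plane_eq[OF assms] by auto
  then have "k = tan_coord u w"
    using Y tangent_normal_unique[OF assms] normal_plane_iff[OF assms] by blast
  then show "Y = pd (tan_coord u w) \<phi> u" using k by simp
qed

lemma nor_part_eq:
  assumes "u \<in> U"
  shows "nor_part A F (x u) w = w - pd (tan_coord u w) \<phi> u"
  unfolding nor_part_def
proof (rule the_equality)
  show "w - pd (tan_coord u w) \<phi> u \<in> normal_plane A F (x u) \<and>
      w - (w - pd (tan_coord u w) \<phi> u) \<in> tangent_plane A F (x u)"
    by (simp add: tangent_plane_eq[OF assms] normal_plane_iff[OF assms] tan_coord_orthogonal[OF assms])
  fix Y assume Y: "Y \<in> normal_plane A F (x u) \<and> w - Y \<in> tangent_plane A F (x u)"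
  then obtain k where "w - Y = pd k \<phi> u" using tangent_plane_eq[OF assms] by auto
  then have Yk: "Y = w - pd k \<phi> u" by (simp add: algebra_simps)
  then have "k = tan_coord u w"
    using Y tangent_normal_unique[OF assms] normal_plane_iff[OF assms] by blast
  then show "Y = w - pd (tan_coord u w) \<phi> u" using Yk by simp
qed

lemma nor_part_normal:
  "u \<in> U \<Longrightarrow> nor_part A F (x u) w \<in> normal_plane A F (x u)"
  by (simp add: nor_part_eq normal_plane_iff tan_coord_orthogonal)

lemma tan_coord_dphi: "u \<in> U \<Longrightarrow> tan_coord u (pd h \<phi> u) = h"
  by (rule tangent_normal_unique[symmetric]) auto

lemma linear_tan_coord: "linear (tan_coord u)"
  by (rule linearI)
    (simp_all add: tan_coord_def inner_add_left algebra_simps add_divide_distrib diff_divide_distrib)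

lemma linear_nor_part:
  assumes "u \<in> U"
  shows "linear (nor_part A F (x u))"
proof -
  have "linear (\<lambda>w. w - pd (tan_coord u w) \<phi> u)"
    using linear_compose_sub[OF linear_id linear_compose[OF linear_tan_coord linear_dphi[OF assms]]]
    by (simp add: o_def)
  then show ?thesis using nor_part_eq[OF assms] by presburger
qed

lemma nor_part_tangent: "u \<in> U \<Longrightarrow> nor_part A F (x u) (pd h \<phi> u) = 0"
  by (simp add: nor_part_eq tan_coord_dphi)

lemma nor_part_add_tangent:
  "u \<in> U \<Longrightarrow> nor_part A F (x u) (w + pd h \<phi> u) = nor_part A F (x u) w"
  by (simp add: linear_add[OF linear_nor_part] nor_part_tangent)

lemma smooth_on_tan_coord:
  assumes "open S" "S \<subseteq> U" "smooth_on S w"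
  shows "smooth_on S (\<lambda>u. tan_coord u (w u))"
proof -
  have P: "smooth_on S (pd h \<phi>)" for h
    using smooth_on_subset[OF smooth_on_pd[OF smooth_phi] assms(2)] .
  have "gram u \<noteq> 0" if "u \<in> S" for u using that assms(2) gram_nonzero by auto
  then show ?thesis
    unfolding tan_coord_def gram_def
    by (intro smooth_on_add smooth_on_scaleR smooth_on_divide smooth_on_diff smooth_on_mult
        smooth_on_inner smooth_on_const P assms) simp_all
qed

definition coords :: "('a \<Rightarrow> real^4) \<Rightarrow> real^2 \<Rightarrow> real^2" where
  "coords X u = tan_coord u (X (x u))"

lemma tangent_field_coords:
  assumes "tangent_field A F W X"
  shows "smooth_on {u \<in> U. x u \<in> W} (coords X)"
    and "u \<in> U \<Longrightarrow> x u \<in> W \<Longrightarrow> X (x u) = pd (coords X u) \<phi> u"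
proof -
  have "open {u \<in> U. x u \<in> W}"
    using assms open_chart_preimage[OF chart] by (auto simp: tangent_field_def)
  moreover have "smooth_on {u \<in> U. x u \<in> W} (X \<circ> x)"
    using assms chart by (fastforce simp: tangent_field_def)
  ultimately show "smooth_on {u \<in> U. x u \<in> W} (coords X)"
    using smooth_on_tan_coord[of "{u \<in> U. x u \<in> W}" "X \<circ> x"] by (simp add: coords_def[abs_def])
  assume u: "u \<in> U" "x u \<in> W"
  then have "X (x u) \<in> range (\<lambda>h. pd h \<phi> u)"
    using assms tangent_plane_eq by (auto simp: tangent_field_def)
  then show "X (x u) = pd (coords X u) \<phi> u" using u tan_coord_dphi by (auto simp: coords_def)
qed

text \<open>Fields with constant coefficients in the chart extend any tangent vector, so the tensors defined
  by local extensions are not vacuous.\<close>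
definition coord_field :: "real^2 \<Rightarrow> 'a \<Rightarrow> real^4" where
  "coord_field h q = pd h \<phi> (inv_into U x q)"

lemma coord_field_at: "u \<in> U \<Longrightarrow> coord_field h (x u) = pd h \<phi> u"
  by (simp add: coord_field_def)

lemma tangent_field_coord_field: "tangent_field A F (x ` U) (coord_field h)"
  unfolding tangent_field_def
proof (intro conjI ballI)
  show "open (x ` U)" by (rule open_image)
  show "coord_field h q \<in> tangent_plane A F q" if "q \<in> x ` U" for q
    using that by (auto simp: coord_field_at tangent_plane_eq)
  fix c assume c: "c \<in> A"
  obtain V y where Vy: "c = (V, y)" by (cases c)
  let ?S = "{u \<in> V. y u \<in> x ` U}"
  have "smooth_on ?S (\<lambda>u. pd h \<phi> ((inv_into U x \<circ> y) u))"
  proof (rule smooth_on_compose[OF _ open_U _ smooth_on_pd[OF smooth_phi]])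
    show "open ?S" using open_chart_preimage[OF _ open_image] c Vy by simp
    show "smooth_on ?S (inv_into U x \<circ> y)" using transition_smooth[OF _ chart] c Vy by simp
    show "(inv_into U x \<circ> y) ` ?S \<subseteq> U" by (auto simp: inv_into_into)
  qed
  then show "case c of (V, y) \<Rightarrow> smooth_on {u \<in> V. y u \<in> x ` U} (coord_field h \<circ> y)"
    by (simp add: Vy coord_field_def o_def)
qed


subsection \<open>Second fundamental form and its covariant derivative\<close>

text \<open>Stated for tangency near the point, with differentiable coefficients in one chart, because
  this is the form in which the field \<open>\<nabla>\<^sup>T\<^sub>X Z\<close> has to be differentiated.\<close>
lemma tangential_along_derivative:
  assumes "open S" "S \<subseteq> U" "u \<in> S" "\<kappa> differentiable at u"
    and Y: "\<And>u. u \<in> S \<Longrightarrow> Y (x u) = pd (\<kappa> u) \<phi> u"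
  shows "((Y \<circ> x) has_derivative (\<lambda>h. pd h (pd (\<kappa> u) \<phi>) u + pd (pd h \<kappa> u) \<phi> u)) (at u)"
proof (rule has_derivative_transform_within_open[OF _ assms(1,3)])
  have "u \<in> U" using assms by auto
  show "((\<lambda>u. pd (\<kappa> u) \<phi> u) has_derivative
      (\<lambda>h. pd h (pd (\<kappa> u) \<phi>) u + pd (pd h \<kappa> u) \<phi> u)) (at u)"
    by (rule has_derivative_pd_along[OF open_U smooth_phi \<open>u \<in> U\<close> has_derivative_ident
        has_derivative_pd[OF assms(4)]])
  show "pd (\<kappa> u') \<phi> u' = (Y \<circ> x) u'" if "u' \<in> S" for u' using Y that by simp
qed

lemma dir_deriv_tangential:
  assumes "open S" "S \<subseteq> U" "u \<in> S" "\<kappa> differentiable at u"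
    and "\<And>u. u \<in> S \<Longrightarrow> Y (x u) = pd (\<kappa> u) \<phi> u"
  shows "dir_deriv A F (x u) (pd h \<phi> u) Y = pd h (pd (\<kappa> u) \<phi>) u + pd (pd h \<kappa> u) \<phi> u"
proof -
  note D = tangential_along_derivative[of S u \<kappa> Y, OF assms]
  have "(Y \<circ> x) differentiable at u" using D by (auto simp: differentiable_def)
  then show ?thesis using dir_deriv_eq[of u Y h] pd_eqI[OF D] assms(2,3) by auto
qed

lemma sff_field_tangential:
  assumes "open S" "S \<subseteq> U" "u \<in> S" "\<kappa> differentiable at u"
    and "\<And>u. u \<in> S \<Longrightarrow> Y (x u) = pd (\<kappa> u) \<phi> u" and "X (x u) = pd a \<phi> u"
  shows "sff_field A F X Y (x u) = nor_part A F (x u) (pd a (pd (\<kappa> u) \<phi>) u)"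
proof -
  have "u \<in> U" using assms by auto
  then show ?thesis
    by (simp add: sff_field_def assms(6) dir_deriv_tangential[of S u \<kappa> Y, OF assms(1-5)]
        nor_part_add_tangent)
qed

lemma nabla_tan_tangential:
  assumes "open S" "S \<subseteq> U" "u \<in> S" "\<kappa> differentiable at u"
    and "\<And>u. u \<in> S \<Longrightarrow> Y (x u) = pd (\<kappa> u) \<phi> u" and "X (x u) = pd a \<phi> u"
  shows "nabla_tan A F X Y (x u) = pd (tan_coord u (pd a (pd (\<kappa> u) \<phi>) u) + pd a \<kappa> u) \<phi> u"
proof -
  have "u \<in> U" using assms by auto
  then show ?thesis
    by (simp add: nabla_tan_def assms(6) dir_deriv_tangential[of S u \<kappa> Y, OF assms(1-5)]
        tan_part_eq linear_add[OF linear_tan_coord] tan_coord_dphi)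
qed

lemma sff_field_eq:
  assumes X: "tangent_field A F W X" and Y: "tangent_field A F W Y" and u: "u \<in> U" "x u \<in> W"
  shows "sff_field A F X Y (x u) = nor_part A F (x u) (pd (coords X u) (pd (coords Y u) \<phi>) u)"
proof (rule sff_field_tangential)
  let ?S = "{u \<in> U. x u \<in> W}"
  show S: "open ?S" using X open_chart_preimage[OF chart] by (auto simp: tangent_field_def)
  show "coords Y differentiable at u"
    using smooth_on_differentiable[OF S tangent_field_coords(1)[OF Y]] u by simp
qed (use tangent_field_coords(2)[OF X] tangent_field_coords(2)[OF Y] u in auto)

lemma nabla_tan_eq:
  assumes X: "tangent_field A F W X" and Y: "tangent_field A F W Y" and u: "u \<in> U" "x u \<in> W"
  shows "nabla_tan A F X Y (x u) =
    pd (tan_coord u (pd (coords X u) (pd (coords Y u) \<phi>) u) + pd (coords X u) (coords Y) u) \<phi> u"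
proof (rule nabla_tan_tangential)
  let ?S = "{u \<in> U. x u \<in> W}"
  show S: "open ?S" using X open_chart_preimage[OF chart] by (auto simp: tangent_field_def)
  show "coords Y differentiable at u"
    using smooth_on_differentiable[OF S tangent_field_coords(1)[OF Y]] u by simp
qed (use tangent_field_coords(2)[OF X] tangent_field_coords(2)[OF Y] u in auto)

lemma sff_eq:
  assumes "u \<in> U"
  shows "sff A F (x u) (pd a \<phi> u) (pd b \<phi> u) = nor_part A F (x u) (pd a (pd b \<phi>) u)"
  unfolding sff_def
proof (rule the_equality)
  have c: "coords (coord_field h) u = h" for h
    by (simp add: coords_def coord_field_at tan_coord_dphi assms)
  have "sff_field A F (coord_field a) (coord_field b) (x u) = nor_part A F (x u) (pd a (pd b \<phi>) u)"
    using sff_field_eq[OF tangent_field_coord_field tangent_field_coord_field, of u a b] assms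
    by (simp add: c)
  then show "\<exists>W X Y. x u \<in> W \<and> tangent_field A F W X \<and> tangent_field A F W Y \<and> X (x u) = pd a \<phi> u \<and>
      Y (x u) = pd b \<phi> u \<and> nor_part A F (x u) (pd a (pd b \<phi>) u) = sff_field A F X Y (x u)"
    using tangent_field_coord_field coord_field_at[OF assms] assms by (metis imageI)
  fix n assume "\<exists>W X Y. x u \<in> W \<and> tangent_field A F W X \<and> tangent_field A F W Y \<and> X (x u) = pd a \<phi> u \<and>
      Y (x u) = pd b \<phi> u \<and> n = sff_field A F X Y (x u)"
  then obtain W X Y where h: "x u \<in> W" "tangent_field A F W X" "tangent_field A F W Y"
    "X (x u) = pd a \<phi> u" "Y (x u) = pd b \<phi> u" "n = sff_field A F X Y (x u)" by blast
  then have "coords X u = a" "coords Y u = b" by (simp_all add: coords_def tan_coord_dphi assms)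
  then show "n = nor_part A F (x u) (pd a (pd b \<phi>) u)"
    using sff_field_eq[OF h(2,3) assms h(1)] h(6) by simp
qed

text \<open>The bilinear combination \<open>\<Sum> \<Gamma>\<^sup>k\<^sub>i\<^sub>j a\<^sup>i b\<^sup>j\<close> of the Christoffel symbols: the tangential part of
  \<open>d\<^sup>2\<phi>[a; b]\<close>, in coordinates.\<close>
definition christoffel :: "real^2 \<Rightarrow> real^2 \<Rightarrow> real^2 \<Rightarrow> real^2" where
  "christoffel u a b = tan_coord u (pd a (pd b \<phi>) u)"

text \<open>The covariant derivative is tensorial: the terms \<open>pd a (coords Y)\<close> and \<open>pd a (coords Z)\<close>, which
  depend on the extensions, occur once in the derivative of \<open>\<alpha>(Y, Z)\<close> and once in the correction
  terms.  What remains involves only the values of the fields at the point.\<close>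
lemma nabla_sff_field_eq:
  assumes X: "tangent_field A F W X" and Y: "tangent_field A F W Y" and Z: "tangent_field A F W Z"
    and u0: "u \<in> U" "x u \<in> W"
    and a: "coords X u = a" and b: "coords Y u = b" and c: "coords Z u = c"
  shows "nabla_sff_field A F X Y Z (x u) = nor_part A F (x u)
    (pd a (pd b (pd c \<phi>)) u - pd a (pd (christoffel u b c) \<phi>) u
       - pd (christoffel u a b) (pd c \<phi>) u - pd b (pd (christoffel u a c) \<phi>) u)"
proof -
  define S where "S = {u \<in> U. x u \<in> W}"
  have S: "open S" "S \<subseteq> U" and u: "u \<in> S"
    using X open_chart_preimage[OF chart] u0 by (auto simp: tangent_field_def S_def)
  note sm = tangent_field_coords(1)[OF X, folded S_def] tangent_field_coords(1)[OF Y, folded S_def]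
    tangent_field_coords(1)[OF Z, folded S_def]
  have D: "(coords Y has_derivative (\<lambda>h. pd h (coords Y) u)) (at u)"
    "(coords Z has_derivative (\<lambda>h. pd h (coords Z) u)) (at u)"
    using sm S u by (auto intro: smooth_on_has_derivative)
  have Xu: "X (x u) = pd a \<phi> u" and Yu: "Y (x u) = pd b \<phi> u"
    using tangent_field_coords(2)[OF X] tangent_field_coords(2)[OF Y] u0 a b by auto
  have smooth2: "smooth_on S (\<lambda>u. pd (V u) (pd (W u) \<phi>) u)"
    if "smooth_on S V" "smooth_on S W" for V W
    using smooth_on_pd_pd_along[OF S(1) open_U smooth_phi smooth_on_ident[OF S(1)] _ that] S(2)
    by simp
  have nor: "pd a (sff_field A F Y Z \<circ> x) u = pd a (pd b (pd c \<phi>)) u + pd (pd a (coords Y) u) (pd c \<phi>) u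
      + pd b (pd (pd a (coords Z) u) \<phi>) u - pd a (pd (christoffel u b c) \<phi>) u
      - pd (pd a (\<lambda>u. christoffel u (coords Y u) (coords Z u)) u) \<phi> u" (is "_ = ?D")
    and nor_diff: "(sff_field A F Y Z \<circ> x) differentiable at u"
  proof -
    let ?\<gamma> = "\<lambda>u. christoffel u (coords Y u) (coords Z u)"
    have "smooth_on S ?\<gamma>"
      unfolding christoffel_def by (intro smooth_on_tan_coord S smooth2 sm)
    then have \<gamma>: "(?\<gamma> has_derivative (\<lambda>h. pd h ?\<gamma> u)) (at u)"
      using S u smooth_on_has_derivative by blast
    have "((\<lambda>u. pd (coords Y u) (pd (coords Z u) \<phi>) u - pd (?\<gamma> u) \<phi> u) has_derivative
       (\<lambda>h. pd h (pd (coords Y u) (pd (coords Z u) \<phi>)) u + pd (pd h (coords Y) u) (pd (coords Z u) \<phi>) u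
         + pd (coords Y u) (pd (pd h (coords Z) u) \<phi>) u
         - (pd h (pd (?\<gamma> u) \<phi>) u + pd (pd h ?\<gamma> u) \<phi> u))) (at u)"
      by (intro has_derivative_diff has_derivative_ident D \<gamma>
          has_derivative_pd_pd_along[where z = "\<lambda>u. u", OF open_U smooth_phi u0(1)]
          has_derivative_pd_along[where z = "\<lambda>u. u", OF open_U smooth_phi u0(1)])
    then have D': "((sff_field A F Y Z \<circ> x) has_derivative
       (\<lambda>h. pd h (pd (coords Y u) (pd (coords Z u) \<phi>)) u + pd (pd h (coords Y) u) (pd (coords Z u) \<phi>) u
         + pd (coords Y u) (pd (pd h (coords Z) u) \<phi>) u
         - (pd h (pd (?\<gamma> u) \<phi>) u + pd (pd h ?\<gamma> u) \<phi> u))) (at u)"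
    proof (rule has_derivative_transform_within_open[OF _ S(1) u])
      fix w assume "w \<in> S"
      then show "pd (coords Y w) (pd (coords Z w) \<phi>) w - pd (?\<gamma> w) \<phi> w = (sff_field A F Y Z \<circ> x) w"
        using sff_field_eq[OF Y Z, of w] by (simp add: S_def nor_part_eq christoffel_def)
    qed
    then show "(sff_field A F Y Z \<circ> x) differentiable at u"
      unfolding differentiable_def by blast
    show "pd a (sff_field A F Y Z \<circ> x) u = ?D"
      unfolding pd_eqI[OF D'] b c by simp
  qed
  let ?N = "nor_part A F (x u)"
  note linN = linear_nor_part[OF u0(1)]
  have 1: "nabla_nor A F X (sff_field A F Y Z) (x u) =
      ?N (pd a (pd b (pd c \<phi>)) u) + ?N (pd (pd a (coords Y) u) (pd c \<phi>) u)
      + ?N (pd b (pd (pd a (coords Z) u) \<phi>) u) - ?N (pd a (pd (christoffel u b c) \<phi>) u)"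
    unfolding nabla_nor_def Xu dir_deriv_eq[OF u0(1) nor_diff] nor
    by (simp add: linear_add[OF linN] linear_diff[OF linN] nor_part_tangent[OF u0(1)])
  have nXY: "nabla_tan A F X Y (x u) = pd (christoffel u a b + pd a (coords Y) u) \<phi> u"
    using nabla_tan_eq[OF X Y u0] by (simp add: a b christoffel_def)
  have "sff_field A F (nabla_tan A F X Y) Z (x u) = ?N (pd (christoffel u a b + pd a (coords Y) u) (pd c \<phi>) u)"
    using sff_field_tangential[of S u "coords Z" Z "nabla_tan A F X Y", OF S u _ _ nXY] D(2) tangent_field_coords(2)[OF Z]
    by (auto simp: differentiable_def S_def c)
  then have 2: "sff_field A F (nabla_tan A F X Y) Z (x u) =
      ?N (pd (christoffel u a b) (pd c \<phi>) u) + ?N (pd (pd a (coords Y) u) (pd c \<phi>) u)"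
    by (simp add: linear_add[OF linN]
        linear_add[OF pd_linear[OF smooth_on_differentiable[OF open_U smooth_on_pd[OF smooth_phi] u0(1)]]])
  let ?\<kappa> = "\<lambda>u. tan_coord u (pd (coords X u) (pd (coords Z u) \<phi>) u) + pd (coords X u) (coords Z) u"
  have "smooth_on S ?\<kappa>"
    by (intro smooth_on_add smooth_on_tan_coord S smooth2 sm
        smooth_on_pd_along[OF S(1) S(1) sm(3) smooth_on_ident[OF S(1)]]) auto
  then have "?\<kappa> differentiable at u" using S u smooth_on_differentiable by blast
  then have "sff_field A F Y (nabla_tan A F X Z) (x u) = ?N (pd b (pd (?\<kappa> u) \<phi>) u)"
    using sff_field_tangential[of S u ?\<kappa> "nabla_tan A F X Z" Y, OF S u _ _ Yu] nabla_tan_eq[OF X Z]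
    by (simp add: S_def)
  then have 3: "sff_field A F Y (nabla_tan A F X Z) (x u) =
      ?N (pd b (pd (christoffel u a c) \<phi>) u) + ?N (pd b (pd (pd a (coords Z) u) \<phi>) u)"
    by (simp add: linear_add[OF linN] linear_add[OF linear_pd_pd[OF open_U smooth_phi u0(1)]] 
        a c christoffel_def)
  show ?thesis
    unfolding nabla_sff_field_def 1 2 3 by (simp add: linear_diff[OF linN])
qed

lemma nabla_sff_eq:
  assumes "u \<in> U"
  shows "nabla_sff A F (x u) (pd a \<phi> u) (pd b \<phi> u) (pd c \<phi> u) = nor_part A F (x u)
    (pd a (pd b (pd c \<phi>)) u - pd a (pd (christoffel u b c) \<phi>) u
       - pd (christoffel u a b) (pd c \<phi>) u - pd b (pd (christoffel u a c) \<phi>) u)" (is "_ = ?R")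
  unfolding nabla_sff_def
proof (rule the_equality)
  have c: "coords (coord_field h) u = h" for h
    by (simp add: coords_def coord_field_at tan_coord_dphi assms)
  have "nabla_sff_field A F (coord_field a) (coord_field b) (coord_field c) (x u) = ?R"
    by (rule nabla_sff_field_eq[OF tangent_field_coord_field tangent_field_coord_field
          tangent_field_coord_field]) (simp_all add: assms c)
  then show "\<exists>W X Y Z. x u \<in> W \<and> tangent_field A F W X \<and> tangent_field A F W Y \<and> tangent_field A F W Z \<and>
      X (x u) = pd a \<phi> u \<and> Y (x u) = pd b \<phi> u \<and> Z (x u) = pd c \<phi> u \<and>
      ?R = nabla_sff_field A F X Y Z (x u)"
    using tangent_field_coord_field coord_field_at[OF assms] imageI[OF assms, of x]
    by (intro exI[of _ "x ` U"] exI[of _ "coord_field a"] exI[of _ "coord_field b"]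
        exI[of _ "coord_field c"]) simp
  fix n assume "\<exists>W X Y Z. x u \<in> W \<and> tangent_field A F W X \<and> tangent_field A F W Y \<and>
      tangent_field A F W Z \<and> X (x u) = pd a \<phi> u \<and> Y (x u) = pd b \<phi> u \<and> Z (x u) = pd c \<phi> u \<and>
      n = nabla_sff_field A F X Y Z (x u)"
  then obtain W X Y Z where h: "x u \<in> W" "tangent_field A F W X" "tangent_field A F W Y"
    "tangent_field A F W Z" "X (x u) = pd a \<phi> u" "Y (x u) = pd b \<phi> u" "Z (x u) = pd c \<phi> u"
    "n = nabla_sff_field A F X Y Z (x u)" by blast
  show "n = ?R"
    unfolding h(8)
    by (rule nabla_sff_field_eq[OF h(2-4) assms h(1)]) (simp_all add: coords_def tan_coord_dphi assms h)
qed

end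

section \<open>Derivatives of curves\<close>

lemma nth_deriv_0 [simp]: "nth_deriv 0 \<mu> = \<mu>"
  by (simp add: nth_deriv_def)

lemma nth_deriv_Suc: "nth_deriv (Suc k) \<mu> t = vector_derivative (nth_deriv k \<mu>) (at t)"
  by (simp add: nth_deriv_def)

lemma smooth_on_has_vector_derivative:
  fixes \<mu> :: "real \<Rightarrow> 'b::real_normed_vector"
  assumes "open J" "smooth_on J \<mu>" "t \<in> J"
  shows "(\<mu> has_vector_derivative pd 1 \<mu> t) (at t)"
proof -
  note D = smooth_on_has_derivative[OF assms]
  have eq: "pd h \<mu> t = h *\<^sub>R pd 1 \<mu> t" for h
    using linear_scale[OF has_derivative_linear[OF D], of h 1] by simp
  from D show ?thesis
    unfolding has_vector_derivative_def by (rule has_derivative_eq_rhs) (rule ext, rule eq)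
qed

lemma smooth_on_nth_deriv:
  fixes \<mu> :: "real \<Rightarrow> 'b::real_normed_vector"
  assumes "open J" "smooth_on J \<mu>"
  shows "smooth_on J (nth_deriv k \<mu>)"
proof (induction k)
  case (Suc k)
  have "pd 1 (nth_deriv k \<mu>) t = nth_deriv (Suc k) \<mu> t" if "t \<in> J" for t
    unfolding nth_deriv_Suc
    by (rule vector_derivative_at[OF smooth_on_has_vector_derivative[OF assms(1) Suc that], symmetric])
  then show ?case
    by (rule smooth_on_cong[OF assms(1) _ smooth_on_pd[OF Suc]])
qed (simp add: assms)

lemma nth_deriv_has_vector_derivative:
  fixes \<mu> :: "real \<Rightarrow> 'b::real_normed_vector"
  assumes "open J" "smooth_on J \<mu>" "t \<in> J"
  shows "(nth_deriv k \<mu> has_vector_derivative nth_deriv (Suc k) \<mu> t) (at t)"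
proof -
  have D: "(nth_deriv k \<mu> has_vector_derivative pd 1 (nth_deriv k \<mu>) t) (at t)"
    by (rule smooth_on_has_vector_derivative[OF assms(1) smooth_on_nth_deriv[OF assms(1,2)] assms(3)])
  show ?thesis unfolding nth_deriv_Suc vector_derivative_at[OF D] by (rule D)
qed

lemma nth_deriv_SucI:
  fixes \<mu> :: "real \<Rightarrow> 'b::real_normed_vector"
  assumes "open J" "t \<in> J" "\<And>s. s \<in> J \<Longrightarrow> nth_deriv k \<mu> s = \<nu> s"
    and "(\<nu> has_vector_derivative D) (at t)"
  shows "nth_deriv (Suc k) \<mu> t = D"
  unfolding nth_deriv_Suc
  by (rule vector_derivative_at, rule has_vector_derivative_transform_within_open[OF assms(4,1,2)])
    (simp add: assms(3))

lemma nth_deriv_eq_0: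
  fixes \<mu> :: "real \<Rightarrow> 'b::real_normed_vector"
  assumes "open J" "\<And>t. t \<in> J \<Longrightarrow> \<mu> t = 0" "t \<in> J"
  shows "nth_deriv k \<mu> t = 0"
  using assms(3)
proof (induction k arbitrary: t)
  case (Suc k)
  show ?case
    by (rule nth_deriv_SucI[OF assms(1) Suc.prems Suc.IH, where D = 0]) simp_all
qed (simp add: assms(2))

text \<open>Bootstrapping: if \<open>z\<close> is of class \<open>C\<^sup>k\<close> then so is \<open>z' = G \<circ> z\<close>, hence \<open>z\<close> is one class better.\<close>
lemma smooth_on_autonomous_ode:
  fixes z :: "real \<Rightarrow> 'b::euclidean_space"
  assumes "open J" "open S" "smooth_on S G" "z ` J \<subseteq> S"
    and z: "\<And>t. t \<in> J \<Longrightarrow> (z has_vector_derivative G (z t)) (at t)"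
  shows "smooth_on J z"
  unfolding smooth_on_def
proof
  fix k show "Ck_on k z J"
  proof (induction k)
    case 0
    show ?case
      using z assms(1) has_vector_derivative_continuous
      by (simp add: continuous_on_eq_continuous_at) blast
  next
    case (Suc k)
    show ?case
    proof (rule Ck_on_SucI[OF \<open>open J\<close>, where f' = "\<lambda>h t. h *\<^sub>R G (z t)"])
      show "(z has_derivative (\<lambda>h. h *\<^sub>R G (z t))) (at t)" if "t \<in> J" for t
        using z[OF that] by (simp only: has_vector_derivative_def)
      have "Ck_on k G S" using assms(3) by (simp add: smooth_on_def)
      then have "Ck_on k (\<lambda>t. G (z t)) J"
        by (rule Ck_on_compose[OF assms(1,2) Suc _ assms(4)])
      then show "Ck_on k (\<lambda>t. h *\<^sub>R G (z t)) J" for h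
        by (rule Ck_on_bilinear[OF bounded_bilinear_scaleR assms(1) Ck_on_const])
    qed
  qed
qed

lemma nth_deriv_bounded_linear:
  fixes \<mu> :: "real \<Rightarrow> 'b::real_normed_vector"
  assumes "bounded_linear T" "open J" "smooth_on J \<mu>" "t \<in> J"
  shows "nth_deriv (Suc k) (\<lambda>t. T (\<mu> t - q)) t = T (nth_deriv (Suc k) \<mu> t)"
  using assms(4)
proof (induction k arbitrary: t)
  case 0
  have "((\<lambda>t. T (\<mu> t - q)) has_vector_derivative T (nth_deriv 1 \<mu> t - 0)) (at t)"
    using nth_deriv_has_vector_derivative[OF assms(2,3) 0, of 0]
    by (intro bounded_linear.has_vector_derivative[OF assms(1)] has_vector_derivative_diff) simp_all
  then show ?case by (simp add: nth_deriv_Suc vector_derivative_at)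
next
  case (Suc k)
  show ?case
    by (rule nth_deriv_SucI[OF assms(2) Suc.prems Suc.IH], assumption)
      (rule bounded_linear.has_vector_derivative[OF assms(1)
        nth_deriv_has_vector_derivative[OF assms(2,3) Suc.prems]])
qed

text \<open>The unit tangent changes only by the component of the acceleration orthogonal to the velocity.\<close>
lemma curvature_eq:
  fixes \<mu> :: "real \<Rightarrow> 'b::real_inner"
  assumes "open J" "smooth_on J \<mu>" "t \<in> J" "nth_deriv 1 \<mu> t \<noteq> 0"
  defines "d1 \<equiv> nth_deriv 1 \<mu> t" and "d2 \<equiv> nth_deriv 2 \<mu> t"
  shows "curvature \<mu> t = norm (d2 - ((d2 \<bullet> d1) / (d1 \<bullet> d1)) *\<^sub>R d1) / (norm d1)\<^sup>2"
proof -
  let ?v = "nth_deriv 1 \<mu>"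
  have D: "(?v has_derivative (\<lambda>h. h *\<^sub>R d2)) (at t)"
    using nth_deriv_has_vector_derivative[OF assms(1-3), of 1]
    unfolding d2_def has_vector_derivative_def Suc_1 .
  have n: "norm d1 \<noteq> 0" using assms(4) by (simp add: d1_def)
  have N: "((\<lambda>s. norm (?v s)) has_derivative (\<lambda>h. (h *\<^sub>R d2) \<bullet> sgn d1)) (at t)"
    using has_derivative_compose[OF D has_derivative_norm[OF assms(4)]] unfolding d1_def .
  have dd: "d1 \<bullet> d1 = norm d1 * norm d1"
    unfolding power2_eq_square[symmetric] power2_norm_eq_inner ..
  have D': "((\<lambda>s. ?v s /\<^sub>R norm (?v s)) has_derivative
      (\<lambda>h. inverse (norm d1) *\<^sub>R (h *\<^sub>R d2)
        + (- (inverse (norm d1) * ((h *\<^sub>R d2) \<bullet> sgn d1) * inverse (norm d1))) *\<^sub>R d1)) (at t)"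
    using has_derivative_scaleR[OF Deriv.has_derivative_inverse[OF n[unfolded d1_def] N] D]
    unfolding d1_def .
  have eq: "inverse (norm d1) *\<^sub>R (h *\<^sub>R d2)
        + (- (inverse (norm d1) * ((h *\<^sub>R d2) \<bullet> sgn d1) * inverse (norm d1))) *\<^sub>R d1
      = h *\<^sub>R (inverse (norm d1) *\<^sub>R (d2 - ((d2 \<bullet> d1) / (d1 \<bullet> d1)) *\<^sub>R d1))" for h
  proof -
    have "inverse (norm d1) * ((h *\<^sub>R d2) \<bullet> sgn d1) * inverse (norm d1)
        = h * (inverse (norm d1) * ((d2 \<bullet> d1) / (d1 \<bullet> d1)))"
      unfolding dd sgn_div_norm divide_inverse by simp
    then show ?thesis by (simp only:) (simp add: scaleR_diff_right)
  qed
  from D' have "((\<lambda>s. ?v s /\<^sub>R norm (?v s)) has_vector_derivative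
      (inverse (norm d1) *\<^sub>R (d2 - ((d2 \<bullet> d1) / (d1 \<bullet> d1)) *\<^sub>R d1))) (at t)"
    unfolding has_vector_derivative_def by (rule has_derivative_eq_rhs) (rule ext, rule eq)
  then have "vector_derivative (\<lambda>s. ?v s /\<^sub>R norm (?v s)) (at t)
      = inverse (norm d1) *\<^sub>R (d2 - ((d2 \<bullet> d1) / (d1 \<bullet> d1)) *\<^sub>R d1)"
    by (rule vector_derivative_at)
  then show ?thesis
    unfolding curvature_def d1_def[symmetric] by (simp add: power2_eq_square divide_inverse)
qed

section \<open>Curves on the surface\<close>

context surface_chart
begin

lemma curve_in_chart:
  assumes c: "smooth_curve A I c" "open I"
  defines "J \<equiv> {t \<in> I. c t \<in> x ` U}" and "z \<equiv> inv_into U x \<circ> c"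
  shows "open J" "smooth_on J z" "smooth_on J (F \<circ> c)"
    and "t \<in> J \<Longrightarrow> z t \<in> U" "t \<in> J \<Longrightarrow> x (z t) = c t"
proof -
  have "continuous_on I c" using c(1) by (simp add: smooth_curve_def)
  then have "open (I \<inter> c -` (x ` U))"
    by (rule continuous_open_preimage[OF _ c(2) open_image])
  then show J: "open J" by (simp add: J_def Int_def)
  show z: "smooth_on J z"
    using c(1) chart unfolding smooth_curve_def J_def z_def by blast
  show *: "t \<in> J \<Longrightarrow> z t \<in> U" "t \<in> J \<Longrightarrow> x (z t) = c t" for t
    by (auto simp: J_def z_def inv_into_into f_inv_into_f)
  have "smooth_on J (\<lambda>t. \<phi> (z t))"
    by (rule smooth_on_compose[OF J open_U z smooth_phi]) (use *(1) in blast)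
  then show "smooth_on J (F \<circ> c)"
    by (rule smooth_on_cong[OF J, rotated]) (simp add: *(2))
qed

text \<open>Repeated use of the chain and product rules.  Of the three mixed terms of the third derivative two
  coincide; \<open>pd z2 (pd z1 \<phi>)\<close> is kept apart because its directions stand in the opposite order,
  matching the order in which they occur in the covariant derivative of the second fundamental form.\<close>
lemma curve_derivatives:
  assumes c: "smooth_curve A I c" "open I" and t: "t \<in> I" "c t \<in> x ` U"
  defines "z \<equiv> inv_into U x \<circ> c"
  defines "z1 \<equiv> nth_deriv 1 z t" and "z2 \<equiv> nth_deriv 2 z t" and "z3 \<equiv> nth_deriv 3 z t"
  shows "nth_deriv 1 (F \<circ> c) t = pd z1 \<phi> (z t)"
    and "nth_deriv 2 (F \<circ> c) t = pd z1 (pd z1 \<phi>) (z t) + pd z2 \<phi> (z t)"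
    and "nth_deriv 3 (F \<circ> c) t = pd z1 (pd z1 (pd z1 \<phi>)) (z t) + pd z2 (pd z1 \<phi>) (z t)
           + pd z1 (pd z2 \<phi>) (z t) + pd z1 (pd z2 \<phi>) (z t) + pd z3 \<phi> (z t)"
proof -
  define J where "J = {t \<in> I. c t \<in> x ` U}"
  note C = curve_in_chart[OF c, folded J_def z_def]
  have tJ: "t \<in> J" using t by (simp add: J_def)
  have Dz: "(nth_deriv k z has_derivative (\<lambda>h. h *\<^sub>R nth_deriv (Suc k) z s)) (at s)"
    if "s \<in> J" for s k
    using nth_deriv_has_vector_derivative[OF C(1,2) that] by (simp add: has_vector_derivative_def)
  have Dz0: "(z has_derivative (\<lambda>h. h *\<^sub>R nth_deriv 1 z s)) (at s)"
    and Dz1: "(nth_deriv 1 z has_derivative (\<lambda>h. h *\<^sub>R nth_deriv 2 z s)) (at s)"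
    and Dz2: "(nth_deriv 2 z has_derivative (\<lambda>h. h *\<^sub>R nth_deriv 3 z s)) (at s)" if "s \<in> J" for s
    using Dz[OF that, of 0] Dz[OF that, of 1] Dz[OF that, of 2]
    by (simp_all add: numeral_2_eq_2 numeral_3_eq_3)
  have scale: "pd (h *\<^sub>R a) f w = h *\<^sub>R pd a f w" if "smooth_on U f" "w \<in> U"
    for h a w and f :: "real^2 \<Rightarrow> real^4"
    by (rule linear_scale[OF pd_linear[OF smooth_on_differentiable[OF open_U that]]])
  note scale2 = linear_scale[OF linear_pd_pd[OF open_U smooth_phi]]
  have sm: "smooth_on U (pd a \<phi>)" "smooth_on U (pd b (pd a \<phi>))" for a b
    by (intro smooth_on_pd smooth_phi)+
  have 1: "nth_deriv 1 (F \<circ> c) s = pd (nth_deriv 1 z s) \<phi> (z s)" if s: "s \<in> J" for s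
  proof -
    have "((\<lambda>s. \<phi> (z s)) has_derivative (\<lambda>h. pd (h *\<^sub>R nth_deriv 1 z s) \<phi> (z s))) (at s)"
      by (rule has_derivative_compose[OF Dz0[OF s] smooth_on_has_derivative[OF open_U smooth_phi C(4)[OF s]]])
    then have "((\<lambda>s. \<phi> (z s)) has_vector_derivative pd (nth_deriv 1 z s) \<phi> (z s)) (at s)"
      by (simp only: has_vector_derivative_def scale[OF smooth_phi C(4)[OF s]])
    then show ?thesis
      using nth_deriv_SucI[OF C(1) s, of 0 "F \<circ> c" "\<lambda>s. \<phi> (z s)"] C(5) by simp
  qed
  have 2: "nth_deriv 2 (F \<circ> c) s = pd (nth_deriv 1 z s) (pd (nth_deriv 1 z s) \<phi>) (z s)
      + pd (nth_deriv 2 z s) \<phi> (z s)" if s: "s \<in> J" for s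
  proof -
    have "((\<lambda>s. pd (nth_deriv 1 z s) \<phi> (z s)) has_vector_derivative
        pd (nth_deriv 1 z s) (pd (nth_deriv 1 z s) \<phi>) (z s) + pd (nth_deriv 2 z s) \<phi> (z s)) (at s)"
      using has_derivative_pd_along[OF open_U smooth_phi C(4)[OF s] Dz0[OF s] Dz1[OF s]]
      by (simp only: has_vector_derivative_def scale[OF _ C(4)[OF s]] sm smooth_phi scaleR_add_right)
    from nth_deriv_SucI[OF C(1) s 1 this] show ?thesis by (simp add: numeral_2_eq_2)
  qed
  have 3: "nth_deriv 3 (F \<circ> c) s =
      (pd (nth_deriv 1 z s) (pd (nth_deriv 1 z s) (pd (nth_deriv 1 z s) \<phi>)) (z s)
        + pd (nth_deriv 2 z s) (pd (nth_deriv 1 z s) \<phi>) (z s)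
        + pd (nth_deriv 1 z s) (pd (nth_deriv 2 z s) \<phi>) (z s))
      + (pd (nth_deriv 1 z s) (pd (nth_deriv 2 z s) \<phi>) (z s)
        + pd (nth_deriv 3 z s) \<phi> (z s))" (is "_ = ?D") if s: "s \<in> J" for s
  proof -
    have "((\<lambda>s. pd (nth_deriv 1 z s) (pd (nth_deriv 1 z s) \<phi>) (z s) + pd (nth_deriv 2 z s) \<phi> (z s))
        has_vector_derivative ?D) (at s)"
      using has_derivative_add[OF
          has_derivative_pd_pd_along[OF open_U smooth_phi C(4)[OF s] Dz0[OF s] Dz1[OF s] Dz1[OF s]]
          has_derivative_pd_along[OF open_U smooth_phi C(4)[OF s] Dz0[OF s] Dz2[OF s]]]
      by (simp only: has_vector_derivative_def scale[OF _ C(4)[OF s]] scale2[OF C(4)[OF s]]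
          sm smooth_phi scaleR_add_right)
    from nth_deriv_SucI[OF C(1) s 2 this] show ?thesis by (simp add: numeral_2_eq_2 numeral_3_eq_3)
  qed
  show "nth_deriv 1 (F \<circ> c) t = pd z1 \<phi> (z t)"
    "nth_deriv 2 (F \<circ> c) t = pd z1 (pd z1 \<phi>) (z t) + pd z2 \<phi> (z t)"
    "nth_deriv 3 (F \<circ> c) t = pd z1 (pd z1 (pd z1 \<phi>)) (z t) + pd z2 (pd z1 \<phi>) (z t)
           + pd z1 (pd z2 \<phi>) (z t) + pd z1 (pd z2 \<phi>) (z t) + pd z3 \<phi> (z t)"
    using 1[OF tJ] 2[OF tJ] 3[OF tJ] by (simp_all add: z1_def z2_def z3_def)
qed

text \<open>The heart of the proof, common to normal sections and geodesics.  The tangential part of the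
  acceleration determines the second derivative of the coordinate curve as
  \<open>z'' = \<sigma> a - \<rho>\<^sup>2 \<Gamma>(a, a)\<close>, where \<open>v = d\<phi>(a)\<close>.  Inserting this in the third derivative, the Christoffel terms
  combine with \<open>d\<^sup>3\<phi>[a; a; a]\<close> to \<open>(\<nabla>\<^sub>v\<alpha>)(v, v)\<close>, and \<open>\<sigma> a\<close> contributes three equal multiples of
  \<open>\<alpha>(v, v)\<close>.\<close>
lemma curve_normal_parts:
  assumes c: "smooth_curve A I c" "open I" "t \<in> I" and u: "u \<in> U" "c t = x u"
    and v: "v \<in> tangent_plane A F (x u)"
    and d1: "nth_deriv 1 (F \<circ> c) t = \<rho> *\<^sub>R v"
    and d2: "tan_part A F (x u) (nth_deriv 2 (F \<circ> c) t) = \<sigma> *\<^sub>R v"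
  shows "nor_part A F (x u) (nth_deriv 2 (F \<circ> c) t) = \<rho>\<^sup>2 *\<^sub>R sff A F (x u) v v"
    and "nor_part A F (x u) (nth_deriv 3 (F \<circ> c) t)
      = \<rho> ^ 3 *\<^sub>R nabla_sff A F (x u) v v v + (3 * \<rho> * \<sigma>) *\<^sub>R sff A F (x u) v v"
proof -
  have "v \<in> range (\<lambda>h. pd h \<phi> u)" using v unfolding tangent_plane_eq[OF u(1)] .
  then obtain a where a: "v = pd a \<phi> u" by blast
  define z where "z = inv_into U x \<circ> c"
  define z1 z2 z3 where "z1 = nth_deriv 1 z t" and "z2 = nth_deriv 2 z t" and "z3 = nth_deriv 3 z t"
  have zt: "z t = u" using u by (simp add: z_def)
  have "c t \<in> x ` U" using u by simp
  note D = curve_derivatives[OF c this, folded z_def, folded z1_def z2_def z3_def, unfolded zt]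
  note lin = linear_dphi[OF u(1)]
  note lin2 = linear_pd_pd[OF open_U smooth_phi u(1)]
  note lin1 = pd_linear[OF smooth_on_differentiable[OF open_U smooth_on_pd[OF smooth_phi] u(1)]]
  note lin12 = pd_linear[OF smooth_on_differentiable[OF open_U smooth_on_pd[OF smooth_on_pd[OF smooth_phi]] u(1)]]
  let ?G = "christoffel u a a"
  have "pd z1 \<phi> u = pd (\<rho> *\<^sub>R a) \<phi> u"
    unfolding linear_scale[OF lin] using D(1) d1 a by simp
  then have z1: "z1 = \<rho> *\<^sub>R a" by (rule iffD1[OF inj_dphi[OF u(1)]])
  have "pd (\<sigma> *\<^sub>R a) \<phi> u = pd (tan_coord u (nth_deriv 2 (F \<circ> c) t)) \<phi> u"
    unfolding linear_scale[OF lin] using d2 a by (simp add: tan_part_eq[OF u(1)])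
  then have "\<sigma> *\<^sub>R a = tan_coord u (nth_deriv 2 (F \<circ> c) t)" by (rule iffD1[OF inj_dphi[OF u(1)]])
  also have "\<dots> = \<rho>\<^sup>2 *\<^sub>R ?G + z2"
    unfolding D(2) z1
    by (simp add: linear_add[OF linear_tan_coord] linear_scale[OF linear_tan_coord] tan_coord_dphi u(1)
        linear_scale[OF lin2] linear_scale[OF lin1] christoffel_def power2_eq_square)
  finally have z2: "z2 = \<sigma> *\<^sub>R a - \<rho>\<^sup>2 *\<^sub>R ?G" by simp
  have linN: "linear (nor_part A F (x u))" by (rule linear_nor_part[OF u(1)])
  let ?N = "nor_part A F (x u)"
  show "?N (nth_deriv 2 (F \<circ> c) t) = \<rho>\<^sup>2 *\<^sub>R sff A F (x u) v v"
    unfolding D(2) z1 a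
      nor_part_add_tangent[OF u(1)] sff_eq[OF u(1)] linear_scale[OF lin2] linear_scale[OF lin1]
      linear_scale[OF linN]
    by (simp add: power2_eq_square)
  \<comment> \<open>Separate from the linearity rules, because \<open>pd (\<rho> *\<^sub>R a) \<phi> = \<rho> *\<^sub>R pd a \<phi>\<close> holds only on \<open>U\<close>.\<close>
  have s3: "pd (\<rho> *\<^sub>R a) (pd (\<rho> *\<^sub>R a) (pd (\<rho> *\<^sub>R a) \<phi>)) u = \<rho> ^ 3 *\<^sub>R pd a (pd a (pd a \<phi>)) u"
  proof -
    have "((\<lambda>y. \<rho>\<^sup>2 *\<^sub>R pd a (pd a \<phi>) y) has_derivative (\<lambda>h. \<rho>\<^sup>2 *\<^sub>R pd h (pd a (pd a \<phi>)) u)) (at u)"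
      by (intro has_derivative_scaleR_right smooth_on_has_derivative[OF open_U] smooth_on_pd smooth_phi u(1))
    then have "(pd (\<rho> *\<^sub>R a) (pd (\<rho> *\<^sub>R a) \<phi>) has_derivative
        (\<lambda>h. \<rho>\<^sup>2 *\<^sub>R pd h (pd a (pd a \<phi>)) u)) (at u)"
    proof (rule has_derivative_transform_within_open[OF _ open_U u(1)])
      fix w assume w: "w \<in> U"
      show "\<rho>\<^sup>2 *\<^sub>R pd a (pd a \<phi>) w = pd (\<rho> *\<^sub>R a) (pd (\<rho> *\<^sub>R a) \<phi>) w"
        using linear_scale[OF linear_pd_pd[OF open_U smooth_phi w]]
          linear_scale[OF pd_linear[OF smooth_on_differentiable[OF open_U smooth_on_pd[OF smooth_phi] w]]]
        by (simp add: power2_eq_square)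
    qed
    from pd_eqI[OF this] show ?thesis
      by (simp add: linear_scale[OF lin12] power2_eq_square power3_eq_cube)
  qed
  have triple: "(3 * \<rho> * \<sigma>) *\<^sub>R w = (\<rho> * \<sigma>) *\<^sub>R w + (\<rho> * \<sigma>) *\<^sub>R w + (\<rho> * \<sigma>) *\<^sub>R w"
    for w :: "real^4"
    by (simp add: scaleR_add_left[symmetric] algebra_simps)
  \<comment> \<open>\<open>real^4\<close> is also a ring, in which \<open>algebra_simps\<close> collects \<open>w + w\<close> to \<open>2 * w\<close>.\<close>
  have two: "?N (2 * w) = 2 * ?N w" for w
    unfolding mult_2 by (rule linear_add[OF linN])
  show "?N (nth_deriv 3 (F \<circ> c) t)
      = \<rho> ^ 3 *\<^sub>R nabla_sff A F (x u) v v v + (3 * \<rho> * \<sigma>) *\<^sub>R sff A F (x u) v v"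
    unfolding D(3) z1 a s3 triple nor_part_add_tangent[OF u(1)] nabla_sff_eq[OF u(1)] sff_eq[OF u(1)] z2
    by (simp add: linear_add[OF linN] linear_diff[OF linN] linear_scale[OF linN]
        linear_scale[OF lin2] linear_scale[OF lin1] linear_diff[OF lin2] linear_diff[OF lin1]
        algebra_simps power2_eq_square power3_eq_cube two)
qed

end

section \<open>Existence of the normal section\<close>

context surface_chart
begin

text \<open>A tangent vector \<open>w\<close> orthogonal to \<open>v\<close> turns membership in the affine three-space of the normal
  section into the single scalar equation \<open>y \<bullet> w = 0\<close>.\<close>
lemma tangent_complement:
  assumes u: "u \<in> U" and v: "v \<in> tangent_plane A F (x u)" "norm v = 1"
  obtains w where "w \<in> tangent_plane A F (x u)" "w \<noteq> 0" "w \<bullet> v = 0"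
    "\<And>y. y \<in> tangent_plane A F (x u) \<Longrightarrow> y \<bullet> w = 0 \<Longrightarrow> \<exists>r. y = r *\<^sub>R v"
    "\<And>y. y \<in> span (insert v (normal_plane A F (x u))) \<longleftrightarrow> y \<bullet> w = 0"
proof -
  note lin = linear_dphi[OF u]
  have "v \<in> range (\<lambda>h. pd h \<phi> u)" using v(1) unfolding tangent_plane_eq[OF u] .
  then obtain a where a: "v = pd a \<phi> u" by blast
  have "a \<noteq> 0" using a v(2) linear_0[OF lin] by auto
  then have "a $ 1 \<noteq> 0 \<or> a $ 2 \<noteq> 0" by (simp add: vec_eq_iff forall_2)
  then have q: "a $ 1 * a $ 1 + a $ 2 * a $ 2 \<noteq> 0"
    using sum_squares_eq_zero_iff by metis
  \<comment> \<open>The rotation of \<open>a\<close> by 90 degrees completes it to a basis of the parameter plane.\<close>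
  define b where "b = (vector [- a $ 2, a $ 1] :: real^2)"
  have b12: "b $ 1 = - a $ 2" "b $ 2 = a $ 1" by (simp_all add: b_def)
  define k where "k = pd b \<phi> u \<bullet> v"
  define w where "w = pd (b - k *\<^sub>R a) \<phi> u"
  have vv: "v \<bullet> v = 1" using v(2) by (simp add: norm_eq_1)
  have wv: "w \<bullet> v = 0"
    unfolding w_def linear_diff[OF lin] linear_scale[OF lin] a[symmetric]
    by (simp add: inner_diff_left vv k_def)
  have w_tan: "w \<in> tangent_plane A F (x u)" unfolding tangent_plane_eq[OF u] w_def by blast
  have w0: "w \<noteq> 0"
  proof
    assume "w = 0"
    then have "pd (b - k *\<^sub>R a) \<phi> u = pd 0 \<phi> u" using linear_0[OF lin] by (simp add: w_def)
    then have "b - k *\<^sub>R a = 0" by (rule iffD1[OF inj_dphi[OF u]])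
    then have "b $ 1 = k * a $ 1" "b $ 2 = k * a $ 2" by (auto simp: vec_eq_iff)
    then have "a $ 1 * a $ 1 + a $ 2 * a $ 2 = a $ 1 * (k * a $ 2) - a $ 2 * (k * a $ 1)"
      using b12 by algebra
    then show False using q by simp
  qed
  have expand: "\<exists>r s. y = r *\<^sub>R v + s *\<^sub>R w" if "y \<in> tangent_plane A F (x u)" for y
  proof -
    have "y \<in> range (\<lambda>h. pd h \<phi> u)" using that unfolding tangent_plane_eq[OF u] .
    then obtain h where h: "y = pd h \<phi> u" by blast
    define q where "q = a $ 1 * a $ 1 + a $ 2 * a $ 2"
    define s where "s = (h $ 2 * a $ 1 - h $ 1 * a $ 2) / q"
    define r where "r = (h $ 1 * a $ 1 + h $ 2 * a $ 2) / q"
    have "q \<noteq> 0" using \<open>a $ 1 * a $ 1 + a $ 2 * a $ 2 \<noteq> 0\<close> by (simp add: q_def)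
    have "h $ 1 * q = (h $ 1 * a $ 1 + h $ 2 * a $ 2) * a $ 1 - (h $ 2 * a $ 1 - h $ 1 * a $ 2) * a $ 2"
      "h $ 2 * q = (h $ 1 * a $ 1 + h $ 2 * a $ 2) * a $ 2 + (h $ 2 * a $ 1 - h $ 1 * a $ 2) * a $ 1"
      unfolding q_def by algebra+
    then have "h $ 1 = r * a $ 1 - s * a $ 2" "h $ 2 = r * a $ 2 + s * a $ 1"
      using \<open>q \<noteq> 0\<close> by (simp_all add: r_def s_def field_simps)
    then have "h = (r + s * k) *\<^sub>R a + s *\<^sub>R (b - k *\<^sub>R a)"
      by (simp add: vec_eq_iff forall_2 b12 algebra_simps)
    then have "y = (r + s * k) *\<^sub>R v + s *\<^sub>R w"
      using h linear_add[OF lin] linear_scale[OF lin] by (simp add: a w_def)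
    then show ?thesis by blast
  qed
  have perp: "\<exists>r. y = r *\<^sub>R v" if y: "y \<in> tangent_plane A F (x u)" "y \<bullet> w = 0" for y
  proof -
    obtain r s where rs: "y = r *\<^sub>R v + s *\<^sub>R w" using expand[OF y(1)] by blast
    then have "s * (w \<bullet> w) = 0" using y(2) wv by (simp add: rs inner_add_left inner_commute[of v w])
    then have "s = 0" using w0 by simp
    then show ?thesis using rs by auto
  qed
  have span: "y \<in> span (insert v (normal_plane A F (x u))) \<longleftrightarrow> y \<bullet> w = 0" for y
  proof
    have "insert v (normal_plane A F (x u)) \<subseteq> {y. w \<bullet> y = 0}"
      using wv normal_plane_iff[OF u] by (auto simp: w_def inner_commute)
    then have "span (insert v (normal_plane A F (x u))) \<subseteq> {y. w \<bullet> y = 0}"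
      by (rule span_minimal) (rule subspace_hyperplane)
    moreover assume "y \<in> span (insert v (normal_plane A F (x u)))"
    ultimately show "y \<bullet> w = 0" by (auto simp: inner_commute)
  next
    assume y: "y \<bullet> w = 0"
    let ?n = "nor_part A F (x u) y" and ?t = "pd (tan_coord u y) \<phi> u"
    have n: "?n \<in> normal_plane A F (x u)" by (rule nor_part_normal[OF u])
    have yt: "y = ?t + ?n" by (simp add: nor_part_eq[OF u])
    have "?n \<bullet> w = 0" using n normal_plane_iff[OF u] by (simp add: w_def)
    then have "?t \<bullet> w = 0" using y yt by (metis add.right_neutral inner_add_left)
    moreover have "?t \<in> tangent_plane A F (x u)" unfolding tangent_plane_eq[OF u] by blast
    ultimately obtain r where "?t = r *\<^sub>R v" using perp by blast
    then have "y = r *\<^sub>R v + ?n" using yt by simp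
    also have "\<dots> \<in> span (insert v (normal_plane A F (x u)))"
      using n by (intro span_add span_scale span_base) auto
    finally show "y \<in> span (insert v (normal_plane A F (x u)))" .
  qed
  show thesis by (rule that[OF w_tan w0 wv perp span])
qed

lemma open_chart_image:
  assumes "open S" "S \<subseteq> U"
  shows "open (x ` S)"
proof -
  have "x ` S = x ` U \<inter> inv_into U x -` S"
  proof (intro subset_antisym subsetI)
    fix q assume "q \<in> x ` S"
    then obtain u where "u \<in> S" "u \<in> U" "q = x u" using assms(2) by blast
    then show "q \<in> x ` U \<inter> inv_into U x -` S" by simp
  next
    fix q assume "q \<in> x ` U \<inter> inv_into U x -` S"
    then obtain u where "u \<in> U" "q = x u" "inv_into U x q \<in> S" by blast
    then show "q \<in> x ` S" by simp
  qed
  then show ?thesis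
    using continuous_open_preimage[OF cont_inv_x open_image assms(1)] by simp
qed

lemma smooth_curve_chart:
  assumes J: "open J" and z: "smooth_on J z" "z ` J \<subseteq> U"
  shows "smooth_curve A J (x \<circ> z)"
proof -
  have cont: "continuous_on J (x \<circ> z)"
    by (rule continuous_on_compose[OF smooth_on_continuous[OF z(1)] continuous_on_subset[OF cont_x z(2)]])
  have "smooth_on {t \<in> J. (x \<circ> z) t \<in> y ` V} (inv_into V y \<circ> (x \<circ> z))" if Vy: "(V, y) \<in> A" for V y
  proof -
    let ?J = "{t \<in> J. (x \<circ> z) t \<in> y ` V}"
    have "open (J \<inter> (x \<circ> z) -` (y ` V))"
      by (rule continuous_open_preimage[OF cont J chart_facts(2)[OF Vy]])
    then have "open ?J" by (simp add: Int_def)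
    then have "smooth_on ?J (\<lambda>t. (inv_into V y \<circ> x) (z t))"
    proof (rule smooth_on_compose[OF _ open_chart_preimage[OF chart chart_facts(2)[OF Vy]] _
          transition_smooth[OF chart Vy]])
      show "smooth_on ?J z" by (rule smooth_on_subset[OF z(1)]) blast
      show "z ` ?J \<subseteq> {u \<in> U. x u \<in> y ` V}" using z(2) by auto
    qed
    then show ?thesis by (simp add: o_def)
  qed
  then show ?thesis using cont unfolding smooth_curve_def by blast
qed

text \<open>With \<open>w\<close> orthogonal to \<open>v\<close> in the tangent plane, the inverse function theorem applies to the components of
  \<open>\<phi> - \<phi>(u0)\<close> along \<open>v\<close> and \<open>w\<close>.  The section is the zero set of the second component, so
  it is parametrized by the first one.  The theorem gives only differentiability of the inverse; smoothness
  of the curve follows since it solves an autonomous equation with smooth right-hand side.\<close>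
lemma normal_section_exists:
  assumes u0: "u0 \<in> U" and v: "v \<in> tangent_plane A F (x u0)" "norm v = 1"
  shows "\<exists>c. normal_section A F (x u0) v c"
proof -
  obtain w where w: "w \<in> tangent_plane A F (x u0)" "w \<noteq> 0" "w \<bullet> v = 0"
    and perp: "\<And>y. y \<in> tangent_plane A F (x u0) \<Longrightarrow> y \<bullet> w = 0 \<Longrightarrow> \<exists>r. y = r *\<^sub>R v"
    and span: "\<And>y. y \<in> span (insert v (normal_plane A F (x u0))) \<longleftrightarrow> y \<bullet> w = 0"
    using tangent_complement[OF u0 v] by blast
  let ?e1 = "axis 1 1 :: real^2" and ?e2 = "axis 2 1 :: real^2"
  define \<Psi> where "\<Psi> u = ((\<phi> u - \<phi> u0) \<bullet> v) *\<^sub>R ?e1 + ((\<phi> u - \<phi> u0) \<bullet> w) *\<^sub>R ?e2" for u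
  have \<Psi>1: "\<Psi> u $ 1 = (\<phi> u - \<phi> u0) \<bullet> v" and \<Psi>2: "\<Psi> u $ 2 = (\<phi> u - \<phi> u0) \<bullet> w" for u
    by (simp_all add: \<Psi>_def axis_def)
  define d\<Psi> where "d\<Psi> u h = (pd h \<phi> u \<bullet> v) *\<^sub>R ?e1 + (pd h \<phi> u \<bullet> w) *\<^sub>R ?e2" for u h
  have d1: "d\<Psi> u h $ 1 = pd h \<phi> u \<bullet> v" and d2: "d\<Psi> u h $ 2 = pd h \<phi> u \<bullet> w" for u h
    by (simp_all add: d\<Psi>_def axis_def)
  have D: "(\<Psi> has_derivative d\<Psi> u) (at u)" if "u \<in> U" for u
  proof -
    have "((\<lambda>u. \<phi> u - \<phi> u0) has_derivative (\<lambda>h. pd h \<phi> u)) (at u)"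
      using has_derivative_diff[OF smooth_on_has_derivative[OF open_U smooth_phi that]
          has_derivative_const[of "\<phi> u0"]] by simp
    then show ?thesis
      unfolding \<Psi>_def[abs_def] d\<Psi>_def[abs_def]
      by (intro has_derivative_add has_derivative_scaleR_left has_derivative_inner_left)
  qed
  have bl: "bounded_linear (d\<Psi> u)" if "u \<in> U" for u
    using D[OF that] by (rule has_derivative_bounded_linear)
  define B where "B u = Blinfun (d\<Psi> u)" for u
  have B: "blinfun_apply (B u) = d\<Psi> u" if "u \<in> U" for u
    unfolding B_def by (rule bounded_linear_Blinfun_apply[OF bl[OF that]])
  have cont_d: "continuous_on U (\<lambda>u. d\<Psi> u h)" for h
  proof -
    have "continuous_on U (\<lambda>u. pd h \<phi> u)"
      by (rule smooth_on_continuous[OF smooth_on_pd[OF smooth_phi]])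
    then show ?thesis unfolding d\<Psi>_def by (intro continuous_intros)
  qed
  have contB: "continuous_on U B"
  proof (rule continuous_on_blinfun_componentwise)
    show "continuous_on U (\<lambda>u. blinfun_apply (B u) i)" for i
      using cont_d[of i] by (rule continuous_on_eq) (simp add: B)
  qed
  have inj: "inj (d\<Psi> u0)"
  proof (rule linear_injective_0[THEN iffD2, rule_format])
    show "linear (d\<Psi> u0)" by (rule bounded_linear.linear[OF bl[OF u0]])
    fix h assume "d\<Psi> u0 h = 0"
    then have h: "pd h \<phi> u0 \<bullet> v = 0" "pd h \<phi> u0 \<bullet> w = 0" using d1 d2 by (metis zero_index)+
    have "pd h \<phi> u0 \<in> tangent_plane A F (x u0)" unfolding tangent_plane_eq[OF u0] by blast
    then obtain r where r: "pd h \<phi> u0 = r *\<^sub>R v" using perp h(2) by blast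
    then have "r = 0" using h(1) v(2) by auto
    then have "pd h \<phi> u0 = pd 0 \<phi> u0" using r linear_0[OF linear_dphi[OF u0]] by simp
    then show "h = 0" by (rule iffD1[OF inj_dphi[OF u0]])
  qed
  obtain L where L: "linear L" "L \<circ> d\<Psi> u0 = id"
    using linear_injective_left_inverse[OF bounded_linear.linear[OF bl[OF u0]] inj] by blast
  have blL: "bounded_linear L" using L(1) by (simp add: linear_conv_bounded_linear)
  have inv: "Blinfun L o\<^sub>L B u0 = id_blinfun"
    by (rule blinfun_eqI) (use L(2) in \<open>simp add: bounded_linear_Blinfun_apply[OF blL] B[OF u0] fun_eq_iff\<close>)
  have DB: "(\<Psi> has_derivative blinfun_apply (B u)) (at u)" if "u \<in> U" for u
    using D[OF that] by (simp only: B[OF that])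
  obtain U' V g g' where U': "open U'" "U' \<subseteq> U" "u0 \<in> U'" and V: "open V" "\<Psi> u0 \<in> V"
    and hom: "homeomorphism U' V \<Psi> g" and g: "\<And>y. y \<in> V \<Longrightarrow> (g has_derivative (g' y)) (at y)"
    and bij: "\<And>y. y \<in> V \<Longrightarrow> bij (blinfun_apply (B (g y)))"
    using inverse_function_theorem[OF open_U DB contB u0 inv] by metis
  have gV: "g y \<in> U'" "\<Psi> (g y) = y" if "y \<in> V" for y
    using hom that by (auto simp: homeomorphism_def)
  have gU: "g (\<Psi> u) = u" "\<Psi> u \<in> V" if "u \<in> U'" for u
    using hom that by (auto simp: homeomorphism_def)
  have "\<Psi> u0 = 0" by (simp add: \<Psi>_def)
  then obtain \<epsilon> where \<epsilon>: "\<epsilon> > 0" "ball 0 \<epsilon> \<subseteq> V"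
    using V open_contains_ball by metis
  let ?J = "{-\<epsilon><..<\<epsilon>}"
  define z where "z t = g (t *\<^sub>R ?e1)" for t
  have tV: "t *\<^sub>R ?e1 \<in> ball 0 \<epsilon>" "t *\<^sub>R ?e1 \<in> V" if "t \<in> ?J" for t
  proof -
    show "t *\<^sub>R ?e1 \<in> ball 0 \<epsilon>" using that by (simp add: abs_less_iff)
    then show "t *\<^sub>R ?e1 \<in> V" using \<epsilon> by blast
  qed
  have zU: "z t \<in> U'" "\<Psi> (z t) = t *\<^sub>R ?e1" if "t \<in> ?J" for t
    using gV[OF tV(2)[OF that]] by (simp_all add: z_def)
  have z0: "z 0 = u0" using gU(1)[OF U'(3)] \<open>\<Psi> u0 = 0\<close> by (simp add: z_def)

  \<comment> \<open>By Cramer's rule, \<open>G u\<close> is the solution \<open>k\<close> of \<open>d\<Psi> u k = ?e1\<close>.\<close>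
  define det where "det u = (pd ?e1 \<phi> u \<bullet> v) * (pd ?e2 \<phi> u \<bullet> w) - (pd ?e2 \<phi> u \<bullet> v) * (pd ?e1 \<phi> u \<bullet> w)" for u
  define G where "G u = ((pd ?e2 \<phi> u \<bullet> w) / det u) *\<^sub>R ?e1 + (- (pd ?e1 \<phi> u \<bullet> w) / det u) *\<^sub>R ?e2" for u
  have dd: "d\<Psi> u k $ 1 = k $ 1 * (pd ?e1 \<phi> u \<bullet> v) + k $ 2 * (pd ?e2 \<phi> u \<bullet> v)"
    "d\<Psi> u k $ 2 = k $ 1 * (pd ?e1 \<phi> u \<bullet> w) + k $ 2 * (pd ?e2 \<phi> u \<bullet> w)" if "u \<in> U" for u k
    unfolding d1 d2 dphi_expand[OF that, of k] by (simp_all add: inner_add_left)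
  have solve: "det u \<noteq> 0 \<and> (\<forall>k. d\<Psi> u k = ?e1 \<longrightarrow> k = G u)" if "u \<in> U'" for u
  proof -
    have uU: "u \<in> U" using that U' by blast
    define p1 p2 q1 q2 where "p1 = pd ?e1 \<phi> u \<bullet> v" and "p2 = pd ?e2 \<phi> u \<bullet> v"
      and "q1 = pd ?e1 \<phi> u \<bullet> w" and "q2 = pd ?e2 \<phi> u \<bullet> w"
    have det: "det u = p1 * q2 - p2 * q1" by (simp add: det_def p1_def p2_def q1_def q2_def)
    note dd' = dd[OF uU, folded p1_def p2_def q1_def q2_def]
    have sol: "k $ 1 * det u = q2" "k $ 2 * det u = - q1" if "d\<Psi> u k = ?e1" for k
    proof -
      have "k $ 1 * p1 + k $ 2 * p2 = 1" "k $ 1 * q1 + k $ 2 * q2 = 0"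
        using dd'[of k] that by (simp_all add: axis_def)
      then show "k $ 1 * det u = q2" "k $ 2 * det u = - q1" unfolding det by algebra+
    qed
    have "bij (d\<Psi> u)" using bij[OF gU(2)[OF that]] gU(1)[OF that] B[OF uU] by simp
    then have surj: "\<exists>k. d\<Psi> u k = y" for y by (metis bij_pointE)
    have "det u \<noteq> 0"
    proof
      assume "det u = 0"
      obtain k where "d\<Psi> u k = ?e1" using surj by blast
      from sol[OF this] have "q1 = 0" "q2 = 0" using \<open>det u = 0\<close> by auto
      moreover obtain k' where "d\<Psi> u k' = ?e2" using surj by blast
      ultimately show False using dd'(2)[of k'] by (simp add: axis_def)
    qed
    moreover have "k = G u" if "d\<Psi> u k = ?e1" for k
      using sol[OF that] \<open>det u \<noteq> 0\<close>
      by (simp add: vec_eq_iff forall_2 G_def axis_def q1_def q2_def field_simps)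
    ultimately show ?thesis by blast
  qed
  have smoothG: "smooth_on U' G"
  proof -
    have P: "smooth_on U' (\<lambda>u. pd h \<phi> u \<bullet> k)" for h k
      by (rule smooth_on_inner[OF U'(1) smooth_on_subset[OF smooth_on_pd[OF smooth_phi] U'(2)] smooth_on_const])
    have P': "smooth_on U' (\<lambda>u. - (pd h \<phi> u \<bullet> k))" for h k
      by (rule smooth_on_bounded_linear[OF bounded_linear_minus[OF bounded_linear_ident] U'(1) P])
    have "smooth_on U' det"
      unfolding det_def[abs_def] by (intro smooth_on_diff smooth_on_mult U'(1) P)
    then show ?thesis
      unfolding G_def[abs_def]
      by (intro smooth_on_add smooth_on_scaleR smooth_on_divide smooth_on_const U'(1) P P') (use solve in blast)+
  qed
  have zder: "(z has_vector_derivative G (z t)) (at t)" if t: "t \<in> ?J" for t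
  proof -
    have zt: "z t \<in> U" using zU(1)[OF t] U'(2) by blast
    have z': "(z has_derivative (\<lambda>h. g' (t *\<^sub>R ?e1) (h *\<^sub>R ?e1))) (at t)"
      unfolding z_def[abs_def]
      by (rule has_derivative_compose[OF has_derivative_scaleR_left[OF has_derivative_ident] g[OF tV(2)[OF t]]])
    define k where "k = g' (t *\<^sub>R ?e1) ?e1"
    have lin: "g' (t *\<^sub>R ?e1) (h *\<^sub>R ?e1) = h *\<^sub>R k" for h
      unfolding k_def by (rule linear_scale[OF has_derivative_linear[OF g[OF tV(2)[OF t]]]])
    have zk: "(z has_vector_derivative k) (at t)"
      unfolding has_vector_derivative_def using z' unfolding lin .
    have "((\<lambda>t. \<Psi> (z t)) has_derivative (\<lambda>h. d\<Psi> (z t) (h *\<^sub>R k))) (at t)"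
      by (rule has_derivative_compose[OF zk[unfolded has_vector_derivative_def] D[OF zt]])
    then have "((\<lambda>t. t *\<^sub>R ?e1) has_derivative (\<lambda>h. d\<Psi> (z t) (h *\<^sub>R k))) (at t)"
      by (rule has_derivative_transform_within_open[OF _ open_greaterThanLessThan t]) (rule zU(2))
    moreover have "((\<lambda>t. t *\<^sub>R ?e1) has_derivative (\<lambda>h. h *\<^sub>R ?e1)) (at t)"
      by (rule has_derivative_scaleR_left[OF has_derivative_ident])
    ultimately have "(\<lambda>h. d\<Psi> (z t) (h *\<^sub>R k)) = (\<lambda>h. h *\<^sub>R ?e1)" by (rule has_derivative_unique)
    then have "d\<Psi> (z t) (1 *\<^sub>R k) = 1 *\<^sub>R ?e1" by (rule fun_cong)
    then have "k = G (z t)" using solve[OF zU(1)[OF t]] by simp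
    then show ?thesis using zk by simp
  qed
  have smz: "smooth_on ?J z"
    by (rule smooth_on_autonomous_ode[OF open_greaterThanLessThan U'(1) smoothG _ zder]) (use zU in auto)
  have zJU: "z ` ?J \<subseteq> U" using zU(1) U'(2) by blast
  define c where "c = x \<circ> z"
  have curve: "smooth_curve A ?J c"
    unfolding c_def by (rule smooth_curve_chart[OF open_greaterThanLessThan smz zJU])
  have cz: "c t = x (z t)" for t by (simp add: c_def)
  have Fc: "(F (c t) - F (x u0)) \<bullet> v = t" "(F (c t) - F (x u0)) \<bullet> w = 0" if "t \<in> ?J" for t
    using \<Psi>1[of "z t"] \<Psi>2[of "z t"] zU(2)[OF that] by (simp_all add: cz axis_def)
  have "{t \<in> ?J. c t \<in> x ` U} = ?J" using zJU by (auto simp: cz)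
  then have smF: "smooth_on ?J (F \<circ> c)"
    using curve_in_chart(3)[OF curve open_greaterThanLessThan] by simp
  have reg: "nth_deriv 1 (F \<circ> c) t \<noteq> 0" if t: "t \<in> ?J" for t
  proof -
    have "((F \<circ> c) has_vector_derivative nth_deriv 1 (F \<circ> c) t) (at t)"
      using nth_deriv_has_vector_derivative[OF open_greaterThanLessThan smF t, of 0] by simp
    then have "((\<lambda>t. (F \<circ> c) t - F (x u0)) has_vector_derivative nth_deriv 1 (F \<circ> c) t - 0) (at t)"
      by (intro has_vector_derivative_diff has_vector_derivative_const)
    from bounded_linear.has_vector_derivative[OF bounded_linear_inner_left[of v] this]
    have "((\<lambda>t. ((F \<circ> c) t - F (x u0)) \<bullet> v) has_vector_derivative nth_deriv 1 (F \<circ> c) t \<bullet> v) (at t)"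
      by simp
    then have "((\<lambda>t. t) has_vector_derivative nth_deriv 1 (F \<circ> c) t \<bullet> v) (at t)"
      by (rule has_vector_derivative_transform_within_open[OF _ open_greaterThanLessThan t])
        (simp add: Fc(1))
    then have "nth_deriv 1 (F \<circ> c) t \<bullet> v = 1"
      using vector_derivative_unique_at has_vector_derivative_id by blast
    then show ?thesis by auto
  qed
  have injc: "inj_on c ?J"
  proof (rule inj_onI)
    fix s t assume "s \<in> ?J" "t \<in> ?J" "c s = c t"
    then show "s = t" using Fc(1) by metis
  qed
  \<comment> \<open>The preimage of a ball under \<open>\<Psi>\<close>: the ball meets the first axis exactly in the parameter interval.\<close>
  define W where "W = x ` (g ` ball 0 \<epsilon>)"
  have gb: "g ` ball 0 \<epsilon> = U' \<inter> \<Psi> -` ball 0 \<epsilon>"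
  proof
    show "g ` ball 0 \<epsilon> \<subseteq> U' \<inter> \<Psi> -` ball 0 \<epsilon>"
    proof (intro subsetI, elim imageE)
      fix u y assume "u = g y" "y \<in> ball 0 \<epsilon>"
      then show "u \<in> U' \<inter> \<Psi> -` ball 0 \<epsilon>" using gV[of y] \<epsilon>(2) by (metis IntI subsetD vimageI)
    qed
    show "U' \<inter> \<Psi> -` ball 0 \<epsilon> \<subseteq> g ` ball 0 \<epsilon>" using gU(1) by (metis IntE image_eqI subsetI vimageE)
  qed
  have "continuous_on U' \<Psi>" using hom by (simp add: homeomorphism_def)
  then have "open (g ` ball 0 \<epsilon>)"
    unfolding gb by (rule continuous_open_preimage) (rule U'(1), rule open_ball)
  moreover have "g ` ball 0 \<epsilon> \<subseteq> U" unfolding gb using U'(2) by blast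
  ultimately have "open W" unfolding W_def by (rule open_chart_image)
  have cW: "c t \<in> W" if "t \<in> ?J" for t
    unfolding W_def cz z_def using tV(1)[OF that] by blast
  have J0: "0 \<in> ?J" using \<epsilon>(1) by simp
  have c0: "c 0 = x u0" using z0 by (simp add: cz)
  have "c ` ?J = {q \<in> W. F q - F (x u0) \<in> span (insert v (normal_plane A F (x u0)))}"
  proof (intro subset_antisym subsetI)
    fix q assume "q \<in> c ` ?J"
    then obtain t where "t \<in> ?J" "q = c t" by blast
    then show "q \<in> {q \<in> W. F q - F (x u0) \<in> span (insert v (normal_plane A F (x u0)))}"
      using cW Fc(2) span by simp
  next
    fix q assume q: "q \<in> {q \<in> W. F q - F (x u0) \<in> span (insert v (normal_plane A F (x u0)))}"
    then obtain y where y: "y \<in> ball 0 \<epsilon>" "q = x (g y)" unfolding W_def by blast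
    then have "y \<in> V" using \<epsilon>(2) by blast
    then have "y $ 2 = 0" using \<Psi>2[of "g y"] gV(2)[of y] q y(2) span by simp
    then have yy: "y = (y $ 1) *\<^sub>R ?e1" using vec2_decomp[of y] by simp
    have "\<bar>y $ 1\<bar> < \<epsilon>" using y(1) component_le_norm_cart[of y 1] by simp
    then have "y $ 1 \<in> ?J" by (simp add: abs_less_iff)
    moreover have "q = c (y $ 1)" using y(2) yy by (simp add: cz z_def)
    ultimately show "q \<in> c ` ?J" by blast
  qed
  then have "normal_section A F (x u0) v c"
    unfolding normal_section_def
    using c0 \<epsilon>(1) \<open>open W\<close> cW[OF J0, unfolded c0] curve injc reg
    by (intro conjI exI[of _ \<epsilon>] exI[of _ W] ballI) simp_all
  then show ?thesis by (rule exI[of _ c])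
qed

end

section \<open>Curvature and torsion of the normal section\<close>

text \<open>A remainder orthogonal to \<open>e1\<close> and \<open>e2\<close> in the normal plane would be a fifth nonzero vector of an orthogonal
  system in four-space.\<close>
lemma normal_frame_expansion:
  assumes frame: "normal_frame A F p e1 e2" and n: "n \<in> normal_plane A F p"
    and v: "v \<in> tangent_plane A F p" "v \<noteq> 0" and w: "w \<in> tangent_plane A F p" "w \<noteq> 0" "w \<bullet> v = 0"
  shows "n = (n \<bullet> e1) *\<^sub>R e1 + (n \<bullet> e2) *\<^sub>R e2"
proof (rule ccontr)
  define r where "r = n - (n \<bullet> e1) *\<^sub>R e1 - (n \<bullet> e2) *\<^sub>R e2"
  assume "\<not> ?thesis"
  then have r0: "r \<noteq> 0" by (simp add: r_def algebra_simps)
  have e: "e1 \<in> normal_plane A F p" "e2 \<in> normal_plane A F p" "e1 \<bullet> e1 = 1" "e2 \<bullet> e2 = 1" "e1 \<bullet> e2 = 0"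
    using frame by (auto simp: normal_frame_def norm_eq_1)
  have perp: "k \<bullet> t = 0" if "k \<in> normal_plane A F p" "t \<in> tangent_plane A F p" for k t
    using that by (auto simp: normal_plane_def orthogonal_comp_def orthogonal_def inner_commute)
  have rt: "r \<bullet> t = 0" if "t \<in> tangent_plane A F p" for t
    using perp[OF n that] perp[OF e(1) that] perp[OF e(2) that] by (simp add: r_def inner_diff_left)
  have re: "r \<bullet> e1 = 0" "r \<bullet> e2 = 0"
    using e by (simp_all add: r_def inner_diff_left inner_commute[of e2 e1])
  have ne: "e1 \<noteq> 0" "e2 \<noteq> 0" using e by auto
  have orth: "v \<bullet> w = 0" "v \<bullet> e1 = 0" "v \<bullet> e2 = 0" "v \<bullet> r = 0" "w \<bullet> e1 = 0" "w \<bullet> e2 = 0"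
    "w \<bullet> r = 0" "e1 \<bullet> r = 0" "e2 \<bullet> r = 0"
    using w(3) perp[OF e(1) v(1)] perp[OF e(2) v(1)] perp[OF e(1) w(1)] perp[OF e(2) w(1)]
      rt[OF v(1)] rt[OF w(1)] re by (simp_all add: inner_commute)
  let ?S = "{v, w, e1, e2, r}"
  have "pairwise orthogonal ?S"
    using orth e(5) by (auto simp: pairwise_def orthogonal_def inner_commute)
  moreover have "0 \<notin> ?S" using v(2) w(2) ne r0 by auto
  ultimately have "independent ?S" by (rule pairwise_orthogonal_independent)
  then have "card ?S \<le> DIM(real^4)" using independent_bound by blast
  moreover have "distinct [v, w, e1, e2, r]"
    using orth e(3-5) v(2) w(2) ne r0 by auto
  then have "card ?S = 5" using distinct_card[of "[v, w, e1, e2, r]"] by simp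
  ultimately show False by simp
qed

lemma bounded_linear_frame_coords: "bounded_linear (frame_coords v e1 e2)"
proof -
  have "linear (frame_coords v e1 e2)"
    by (rule linearI)
      (simp_all add: frame_coords_def vec_eq_iff forall_3 inner_add_left)
  then show ?thesis by (simp add: linear_conv_bounded_linear)
qed

text \<open>The summand \<open>3 \<rho> \<sigma> a\<close> of the third derivative is proportional to the last two coordinates of
  the second one, so it disappears from the triple product.  Numerator and denominator both
  scale with \<open>\<rho>\<^sup>6\<close>: the result does not depend on the parametrization.\<close>
lemma torsion_from_coords:
  fixes \<mu> :: "real \<Rightarrow> real^3"
  assumes d1: "nth_deriv 1 \<mu> t = vector [\<rho>, 0, 0]"
    and d2: "nth_deriv 2 \<mu> t = vector [\<sigma>, \<rho>\<^sup>2 * a1, \<rho>\<^sup>2 * a2]"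
    and d3: "nth_deriv 3 \<mu> t =
      vector [s, \<rho> ^ 3 * b1 + 3 * \<rho> * \<sigma> * a1, \<rho> ^ 3 * b2 + 3 * \<rho> * \<sigma> * a2]"
    and \<rho>: "\<rho> \<noteq> 0"
  shows "torsion \<mu> t = (a1 * b2 - a2 * b1) / (a1 * a1 + a2 * a2)"
proof -
  have cr: "cross3 (nth_deriv 1 \<mu> t) (nth_deriv 2 \<mu> t) = vector [0, - (\<rho> ^ 3 * a2), \<rho> ^ 3 * a1]"
    unfolding d1 d2 by (simp add: cross3_def power2_eq_square power3_eq_cube mult.assoc)
  have num: "cross3 (nth_deriv 1 \<mu> t) (nth_deriv 2 \<mu> t) \<bullet> nth_deriv 3 \<mu> t
      = (\<rho> ^ 3)\<^sup>2 * (a1 * b2 - a2 * b1)"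
    unfolding cr d3 by (simp add: inner_vec_def sum_3 power2_eq_square algebra_simps)
  have den: "(norm (cross3 (nth_deriv 1 \<mu> t) (nth_deriv 2 \<mu> t)))\<^sup>2 = (\<rho> ^ 3)\<^sup>2 * (a1 * a1 + a2 * a2)"
    unfolding cr power2_norm_eq_inner by (simp add: inner_vec_def sum_3 power2_eq_square algebra_simps)
  show ?thesis
    unfolding torsion_def num den using \<rho> by simp
qed

context surface_chart
begin

lemma sff_normal:
  assumes u: "u \<in> U" and v: "v \<in> tangent_plane A F (x u)"
  shows "sff A F (x u) v v \<in> normal_plane A F (x u)"
    and "nabla_sff A F (x u) v v v \<in> normal_plane A F (x u)"
proof -
  have "v \<in> range (\<lambda>h. pd h \<phi> u)" using v unfolding tangent_plane_eq[OF u] .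
  then obtain a where a: "v = pd a \<phi> u" by blast
  show "sff A F (x u) v v \<in> normal_plane A F (x u)"
    unfolding a sff_eq[OF u] by (rule nor_part_normal[OF u])
  show "nabla_sff A F (x u) v v v \<in> normal_plane A F (x u)"
    unfolding a nabla_sff_eq[OF u] by (rule nor_part_normal[OF u])
qed

lemma tan_nor_decomp:
  assumes "u \<in> U"
  shows "w = tan_part A F (x u) w + nor_part A F (x u) w"
  unfolding tan_part_eq[OF assms] nor_part_eq[OF assms] by simp

lemma nor_part_inner:
  assumes "u \<in> U" "n \<in> normal_plane A F (x u)"
  shows "n \<bullet> nor_part A F (x u) w = n \<bullet> w"
  using assms(2) unfolding normal_plane_iff[OF assms(1)] nor_part_eq[OF assms(1)]
  by (simp add: inner_diff_right)

text \<open>A normal section satisfies \<open>(F \<circ> c - F p) \<bullet> w = 0\<close> identically.  Differentiating, its velocity and the tangential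
  part of its acceleration are orthogonal to \<open>w\<close>, hence multiples of \<open>v\<close>.\<close>
lemma normal_section_derivatives:
  assumes u: "u \<in> U" and v: "v \<in> tangent_plane A F (x u)" "norm v = 1"
    and c: "normal_section A F (x u) v c"
  obtains J \<rho> \<sigma> where "open J" "0 \<in> J" "smooth_on J (F \<circ> c)" "\<rho> \<noteq> 0"
    "nth_deriv 1 (F \<circ> c) 0 = \<rho> *\<^sub>R v"
    "nth_deriv 2 (F \<circ> c) 0 = \<sigma> *\<^sub>R v + \<rho>\<^sup>2 *\<^sub>R sff A F (x u) v v"
    "nor_part A F (x u) (nth_deriv 3 (F \<circ> c) 0)
      = \<rho> ^ 3 *\<^sub>R nabla_sff A F (x u) v v v + (3 * \<rho> * \<sigma>) *\<^sub>R sff A F (x u) v v"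
proof -
  obtain w where w: "w \<in> tangent_plane A F (x u)" "w \<noteq> 0" "w \<bullet> v = 0"
    and perp: "\<And>y. y \<in> tangent_plane A F (x u) \<Longrightarrow> y \<bullet> w = 0 \<Longrightarrow> \<exists>r. y = r *\<^sub>R v"
    and span: "\<And>y. y \<in> span (insert v (normal_plane A F (x u))) \<longleftrightarrow> y \<bullet> w = 0"
    using tangent_complement[OF u v] by blast
  from c obtain \<epsilon> W where \<epsilon>: "\<epsilon> > 0" and curve: "smooth_curve A {-\<epsilon><..<\<epsilon>} c"
    and reg: "\<forall>t \<in> {-\<epsilon><..<\<epsilon>}. nth_deriv 1 (F \<circ> c) t \<noteq> 0"
    and img: "c ` {-\<epsilon><..<\<epsilon>} = {q \<in> W. F q - F (x u) \<in> span (insert v (normal_plane A F (x u)))}"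
    unfolding normal_section_def by blast
  have c0: "c 0 = x u" using c by (simp add: normal_section_def)
  let ?I = "{-\<epsilon><..<\<epsilon>}"
  have I0: "0 \<in> ?I" using \<epsilon> by simp
  define J where "J = {t \<in> ?I. c t \<in> x ` U}"
  note C = curve_in_chart[OF curve open_greaterThanLessThan, folded J_def]
  have J0: "0 \<in> J" using I0 c0 u by (simp add: J_def)
  have c0U: "c 0 \<in> x ` U" using c0 u by simp
  have zero: "((F \<circ> c) t - F (x u)) \<bullet> w = 0" if "t \<in> J" for t
  proof -
    have "c t \<in> c ` ?I" using that by (simp add: J_def)
    then have "F (c t) - F (x u) \<in> span (insert v (normal_plane A F (x u)))" unfolding img by blast
    then show ?thesis using span by simp
  qed
  have dw: "nth_deriv (Suc k) (F \<circ> c) 0 \<bullet> w = 0" for k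
    using nth_deriv_bounded_linear[OF bounded_linear_inner_left[of w] C(1,3) J0, of k "F (x u)"]
      nth_deriv_eq_0[OF C(1) zero J0, where k = "Suc k"] by simp
  have "nth_deriv 1 (F \<circ> c) 0 \<in> tangent_plane A F (x u)"
    unfolding curve_derivatives(1)[OF curve open_greaterThanLessThan I0 c0U] tangent_plane_eq[OF u]
    using u c0 by auto
  moreover have "nth_deriv 1 (F \<circ> c) 0 \<bullet> w = 0" using dw[of 0] by simp
  ultimately obtain \<rho> where \<rho>: "nth_deriv 1 (F \<circ> c) 0 = \<rho> *\<^sub>R v" using perp by blast
  have \<rho>0: "\<rho> \<noteq> 0" using reg I0 \<rho> by fastforce
  let ?d2 = "nth_deriv 2 (F \<circ> c) 0"
  have w_norm: "nor_part A F (x u) ?d2 \<bullet> w = 0"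
    using nor_part_normal[OF u, of ?d2] w(1) unfolding normal_plane_iff[OF u] tangent_plane_eq[OF u]
    by auto
  have "?d2 \<bullet> w = 0" using dw[of 1] by (simp add: numeral_2_eq_2)
  then have "tan_part A F (x u) ?d2 \<bullet> w = 0"
    using w_norm tan_nor_decomp[OF u, of ?d2] by (metis add.right_neutral inner_add_left)
  moreover have "tan_part A F (x u) ?d2 \<in> tangent_plane A F (x u)"
    unfolding tan_part_eq[OF u] tangent_plane_eq[OF u] by blast
  ultimately obtain \<sigma> where \<sigma>: "tan_part A F (x u) ?d2 = \<sigma> *\<^sub>R v" using perp by blast
  note N = curve_normal_parts[OF curve open_greaterThanLessThan I0 u c0 v(1) \<rho> \<sigma>]
  have "?d2 = \<sigma> *\<^sub>R v + \<rho>\<^sup>2 *\<^sub>R sff A F (x u) v v"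
    using tan_nor_decomp[OF u, of ?d2] unfolding \<sigma> N(1) .
  then show thesis using that[OF C(1) J0 C(3) \<rho>0 \<rho>] N(2) by blast
qed

lemma normal_section_curvature:
  assumes u: "u \<in> U" and v: "v \<in> tangent_plane A F (x u)" "norm v = 1"
    and c: "normal_section A F (x u) v c"
  shows "curvature (F \<circ> c) 0 = norm (sff A F (x u) v v)"
proof -
  obtain J \<rho> \<sigma> where J: "open J" "0 \<in> J" "smooth_on J (F \<circ> c)" and \<rho>: "\<rho> \<noteq> 0"
    and d: "nth_deriv 1 (F \<circ> c) 0 = \<rho> *\<^sub>R v"
      "nth_deriv 2 (F \<circ> c) 0 = \<sigma> *\<^sub>R v + \<rho>\<^sup>2 *\<^sub>R sff A F (x u) v v"
    using normal_section_derivatives[OF u v c] by metis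
  let ?\<alpha> = "sff A F (x u) v v"
  have vv: "v \<bullet> v = 1" using v(2) by (simp add: norm_eq_1)
  have \<alpha>v: "?\<alpha> \<bullet> v = 0"
    using sff_normal(1)[OF u v(1)] v(1) unfolding normal_plane_iff[OF u] tangent_plane_eq[OF u] by auto
  have "nth_deriv 1 (F \<circ> c) 0 \<noteq> 0" using d(1) \<rho> v(2) by auto
  note K = curvature_eq[OF J(1,3,2) this, unfolded d]
  have "((\<sigma> *\<^sub>R v + \<rho>\<^sup>2 *\<^sub>R ?\<alpha>) \<bullet> (\<rho> *\<^sub>R v)) / ((\<rho> *\<^sub>R v) \<bullet> (\<rho> *\<^sub>R v)) = \<sigma> / \<rho>"
    using \<rho> by (simp add: inner_add_left vv \<alpha>v)
  then have "curvature (F \<circ> c) 0 = norm (\<rho>\<^sup>2 *\<^sub>R ?\<alpha>) / (norm (\<rho> *\<^sub>R v))\<^sup>2"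
    unfolding K using \<rho> by simp
  then show ?thesis using \<rho> v(2) by simp
qed

lemma normal_section_torsion:
  assumes u: "u \<in> U" and v: "v \<in> tangent_plane A F (x u)" "norm v = 1"
    and frame: "normal_frame A F (x u) e1 e2" and c: "normal_section A F (x u) v c"
  shows "torsion (\<lambda>t. frame_coords v e1 e2 (F (c t) - F (x u))) 0
    = (rot90 e1 e2 (sff A F (x u) v v) \<bullet> nabla_sff A F (x u) v v v)
        / (sff A F (x u) v v \<bullet> sff A F (x u) v v)"
proof -
  obtain J \<rho> \<sigma> where J: "open J" "0 \<in> J" "smooth_on J (F \<circ> c)" and \<rho>: "\<rho> \<noteq> 0"
    and d: "nth_deriv 1 (F \<circ> c) 0 = \<rho> *\<^sub>R v"
      "nth_deriv 2 (F \<circ> c) 0 = \<sigma> *\<^sub>R v + \<rho>\<^sup>2 *\<^sub>R sff A F (x u) v v"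
      "nor_part A F (x u) (nth_deriv 3 (F \<circ> c) 0)
        = \<rho> ^ 3 *\<^sub>R nabla_sff A F (x u) v v v + (3 * \<rho> * \<sigma>) *\<^sub>R sff A F (x u) v v"
    using normal_section_derivatives[OF u v c] by metis
  define \<alpha> \<beta> where "\<alpha> = sff A F (x u) v v" and "\<beta> = nabla_sff A F (x u) v v v"
  note d = d[folded \<alpha>_def \<beta>_def]
  have vv: "v \<bullet> v = 1" using v(2) by (simp add: norm_eq_1)
  have perp: "n \<bullet> v = 0" "v \<bullet> n = 0" if "n \<in> normal_plane A F (x u)" for n
    using that v(1) unfolding normal_plane_iff[OF u] tangent_plane_eq[OF u] by (auto simp: inner_commute)
  have e: "e1 \<in> normal_plane A F (x u)" "e2 \<in> normal_plane A F (x u)"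
    using frame by (auto simp: normal_frame_def)
  have \<alpha>: "\<alpha> \<in> normal_plane A F (x u)" unfolding \<alpha>_def by (rule sff_normal(1)[OF u v(1)])
  let ?T = "frame_coords v e1 e2" and ?\<mu> = "\<lambda>t. frame_coords v e1 e2 (F (c t) - F (x u))"
  have D: "nth_deriv (Suc k) ?\<mu> 0 = ?T (nth_deriv (Suc k) (F \<circ> c) 0)" for k
    using nth_deriv_bounded_linear[OF bounded_linear_frame_coords J(1,3,2)] by simp
  have D1: "nth_deriv 1 ?\<mu> 0 = ?T (nth_deriv 1 (F \<circ> c) 0)"
    and D2: "nth_deriv 2 ?\<mu> 0 = ?T (nth_deriv 2 (F \<circ> c) 0)"
    and D3: "nth_deriv 3 ?\<mu> 0 = ?T (nth_deriv 3 (F \<circ> c) 0)"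
    using D[of 0] D[of 1] D[of 2] by (simp_all add: numeral_2_eq_2 numeral_3_eq_3)
  have n3: "nth_deriv 3 (F \<circ> c) 0 \<bullet> n = (\<rho> ^ 3 *\<^sub>R \<beta> + (3 * \<rho> * \<sigma>) *\<^sub>R \<alpha>) \<bullet> n"
    if "n \<in> normal_plane A F (x u)" for n
    using nor_part_inner[OF u that, of "nth_deriv 3 (F \<circ> c) 0"] unfolding d(3)
    by (simp only: inner_commute)
  have "torsion ?\<mu> 0 = ((\<alpha> \<bullet> e1) * (\<beta> \<bullet> e2) - (\<alpha> \<bullet> e2) * (\<beta> \<bullet> e1))
      / ((\<alpha> \<bullet> e1) * (\<alpha> \<bullet> e1) + (\<alpha> \<bullet> e2) * (\<alpha> \<bullet> e2))"
  proof (rule torsion_from_coords[OF _ _ _ \<rho>])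
    show "nth_deriv 1 ?\<mu> 0 = vector [\<rho>, 0, 0]"
      unfolding D1 d(1) by (simp add: frame_coords_def vv perp e)
    show "nth_deriv 2 ?\<mu> 0 = vector [\<sigma>, \<rho>\<^sup>2 * (\<alpha> \<bullet> e1), \<rho>\<^sup>2 * (\<alpha> \<bullet> e2)]"
      unfolding D2 d(2) by (simp add: frame_coords_def vv perp e \<alpha> inner_add_left)
    show "nth_deriv 3 ?\<mu> 0 = vector [nth_deriv 3 (F \<circ> c) 0 \<bullet> v,
        \<rho> ^ 3 * (\<beta> \<bullet> e1) + 3 * \<rho> * \<sigma> * (\<alpha> \<bullet> e1), \<rho> ^ 3 * (\<beta> \<bullet> e2) + 3 * \<rho> * \<sigma> * (\<alpha> \<bullet> e2)]"
      unfolding D3 unfolding frame_coords_def n3[OF e(1)] n3[OF e(2)] by (simp add: inner_add_left)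
  qed
  moreover have "\<alpha> \<bullet> \<alpha> = (\<alpha> \<bullet> e1) * (\<alpha> \<bullet> e1) + (\<alpha> \<bullet> e2) * (\<alpha> \<bullet> e2)"
  proof -
    obtain w where w: "w \<in> tangent_plane A F (x u)" "w \<noteq> 0" "w \<bullet> v = 0"
      by (rule tangent_complement[OF u v])
    have "v \<noteq> 0" using v(2) by auto
    from arg_cong[OF normal_frame_expansion[OF frame \<alpha> v(1) this w], of "inner \<alpha>"]
    show ?thesis by (simp only: inner_add_right inner_scaleR_right)
  qed
  moreover have "rot90 e1 e2 \<alpha> \<bullet> \<beta> = (\<alpha> \<bullet> e1) * (\<beta> \<bullet> e2) - (\<alpha> \<bullet> e2) * (\<beta> \<bullet> e1)"
    unfolding rot90_def inner_diff_left inner_scaleR_left by (simp only: inner_commute)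
  ultimately show ?thesis by (simp add: \<alpha>_def \<beta>_def)
qed

text \<open>The case \<open>\<rho> = 1\<close>, \<open>\<sigma> = 0\<close> of the general curve computation.\<close>
lemma geodesic_derivatives:
  assumes u: "u \<in> U" and g: "geodesic A F I \<gamma>" "0 \<in> I" "\<gamma> 0 = x u"
    and v: "nth_deriv 1 (F \<circ> \<gamma>) 0 = v" "v \<in> tangent_plane A F (x u)"
  shows "nth_deriv 2 (F \<circ> \<gamma>) 0 = sff A F (x u) v v"
    and "nor_part A F (x u) (nth_deriv 3 (F \<circ> \<gamma>) 0) = nabla_sff A F (x u) v v v"
proof -
  from g have c: "smooth_curve A I \<gamma>" "open I" and
    t: "tan_part A F (x u) (nth_deriv 2 (F \<circ> \<gamma>) 0) = 0"
    unfolding geodesic_def by auto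
  have "nth_deriv 1 (F \<circ> \<gamma>) 0 = 1 *\<^sub>R v" "tan_part A F (x u) (nth_deriv 2 (F \<circ> \<gamma>) 0) = 0 *\<^sub>R v"
    using v(1) t by simp_all
  note N = curve_normal_parts[OF c g(2) u g(3) v(2) this]
  show "nth_deriv 2 (F \<circ> \<gamma>) 0 = sff A F (x u) v v"
    using tan_nor_decomp[OF u, of "nth_deriv 2 (F \<circ> \<gamma>) 0", unfolded t N(1)] by simp
  show "nor_part A F (x u) (nth_deriv 3 (F \<circ> \<gamma>) 0) = nabla_sff A F (x u) v v v"
    using N(2) by simp
qed

end

theorem mainTheorem5:
  fixes A :: "'a::{t2_space,second_countable_topology} atlas"
    and F :: "'a \<Rightarrow> real^4" and p :: 'a and v e1 e2 :: "real^4"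
  assumes "immersed_surface A F"
    and "v \<in> tangent_plane A F p" and "norm v = 1"
    and "normal_frame A F p e1 e2"
    and "sff A F p v v \<noteq> 0"
  shows "normal_curvature A F p v = norm (sff A F p v v) \<and>
         normal_torsion A F p e1 e2 v =
           (rot90 e1 e2 (sff A F p v v) \<bullet> nabla_sff A F p v v v)
             / (sff A F p v v \<bullet> sff A F p v v) \<and>
         (\<forall>I \<gamma>. geodesic A F I \<gamma> \<and> 0 \<in> I \<and> \<gamma> 0 = p \<and> nth_deriv 1 (F \<circ> \<gamma>) 0 = v \<longrightarrow>
           normal_torsion A F p e1 e2 v =
             (rot90 e1 e2 (nth_deriv 2 (F \<circ> \<gamma>) 0) \<bullet> nth_deriv 3 (F \<circ> \<gamma>) 0)
               / (nth_deriv 2 (F \<circ> \<gamma>) 0 \<bullet> nth_deriv 2 (F \<circ> \<gamma>) 0))"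
proof -
  have "p \<in> (\<Union>(U, x) \<in> A. x ` U)"
    using assms(1) by (simp add: immersed_surface_def surface_atlas_def)
  then obtain U x u where Ux: "(U, x) \<in> A" and u: "u \<in> U" and p: "p = x u" by blast
  interpret surface_chart A F U x
    by (rule surface_chart.intro[OF assms(1) Ux])
  note v = assms(2,3)[unfolded p] and frame = assms(4)[unfolded p]
  obtain c where c: "normal_section A F (x u) v c"
    using normal_section_exists[OF u v] by blast
  have curv: "normal_curvature A F p v = norm (sff A F p v v)"
    unfolding normal_curvature_def p
    by (rule the_equality) (use c normal_section_curvature[OF u v] in metis)+
  have tors: "normal_torsion A F p e1 e2 v =
      (rot90 e1 e2 (sff A F p v v) \<bullet> nabla_sff A F p v v v) / (sff A F p v v \<bullet> sff A F p v v)"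
    unfolding normal_torsion_def p
    by (rule the_equality) (use c normal_section_torsion[OF u v frame] in metis)+
  have "normal_torsion A F p e1 e2 v =
      (rot90 e1 e2 (nth_deriv 2 (F \<circ> \<gamma>) 0) \<bullet> nth_deriv 3 (F \<circ> \<gamma>) 0)
        / (nth_deriv 2 (F \<circ> \<gamma>) 0 \<bullet> nth_deriv 2 (F \<circ> \<gamma>) 0)"
    if g: "geodesic A F I \<gamma>" "0 \<in> I" "\<gamma> 0 = p" "nth_deriv 1 (F \<circ> \<gamma>) 0 = v" for I \<gamma>
  proof -
    note G = geodesic_derivatives[OF u g(1,2) g(3)[unfolded p] g(4) v(1)]
    have "rot90 e1 e2 (sff A F p v v) \<in> normal_plane A F (x u)"
      using frame unfolding normal_frame_def normal_plane_iff[OF u]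
      by (simp add: rot90_def inner_diff_left)
    then show ?thesis
      unfolding tors using G nor_part_inner[OF u] unfolding p by metis
  qed
  then show ?thesis using curv tors by blast
qed

end
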